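(* Let $u$ be a nonnegative, bounded weak solution to $$-\Delta_p u(x)+\lambda_0(x)\,u_+^q(x)=0 \ \text{ in } \Omega,\qquad u=g \ \text{ on } \partial\Omega,$$ let $\Omega'\Subset\Omega$ and let $x_0\in\overline{\{u>0\}}\cap\Omega'$. Then there exists a universal constant $\mathfrak C_0=\mathfrak C_0\left(N,p,q,\inf_\Omega\lambda_0\right)>0$ such that for all $0<r<\min\{1,\mathrm{dist}(\Omega',\partial\Omega)\}$ there holds $$\sup_{\partial B_r(x_0)}u(x)\ \ge\ \mathfrak C_0\, r^{\frac{p}{p-1-q}} .$$
   Context: $\Omega\subset\mathbb R^N$ is a regular bounded domain, $2\le p<\infty$, $0\le q<p-1$, $\lambda_0$ is a bounded function on $\Omega$ which is bounded away from zero ($0<\inf_\Omega\lambda_0\le\sup_\Omega\lambda_0<\infty$), and $0\le g\in C^0(\partial\Omega)$. $\Delta_p u=\mathrm{div}(|\nabla u|^{p-2}\nabla u)$, $u_+=\max\{u,0\}$, and for $q=0$ the term $u_+^0$ means $\chi_{\{u>0\}}$. A weak solution is a function $u\in W^{1,p}_{\rm loc}(\Omega)$ with $\int_\Omega|\nabla u|^{p-2}\nabla u\cdot\nabla\varphi\,dx=-\int_\Omega\lambda_0u_+^q\varphi\,dx$ for all $0\le\varphi\in C^1_0(\Omega)$ (weak solutions are continuous), with $u=g$ on $\partial\Omega$. A universal constant depends only on the indicated parameters (in particular not on $u$). *)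

theory Defs
  imports "HOL-Analysis.Analysis"
begin

text \<open>
  A member of \<open>C\<^sup>1\<^sub>0(\<Omega>)\<close> together with its gradient. Test functions have compact
  support in \<open>\<Omega>\<close> and are identified with their extension by zero.
\<close>

definition C1_0 ::
  "(real ^ 'n) set \<Rightarrow> (real ^ 'n \<Rightarrow> real) \<Rightarrow> (real ^ 'n \<Rightarrow> real ^ 'n) \<Rightarrow> bool"
  where
  "C1_0 \<Omega> \<phi> D\<phi> \<longleftrightarrow>
     (\<forall>x. GDERIV \<phi> x :> D\<phi> x) \<and> continuous_on UNIV D\<phi> \<and>
     compact (closure {x. \<phi> x \<noteq> 0}) \<and> closure {x. \<phi> x \<noteq> 0} \<subseteq> \<Omega>"

definition Lp_loc ::
  "real \<Rightarrow> (real ^ 'n) set \<Rightarrow> (real ^ 'n \<Rightarrow> 'b::euclidean_space) \<Rightarrow> bool" where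
  "Lp_loc p \<Omega> f \<longleftrightarrow>
     f \<in> borel_measurable (lebesgue_on \<Omega>) \<and>
     (\<forall>K. compact K \<and> K \<subseteq> \<Omega> \<longrightarrow> integrable (lebesgue_on K) (\<lambda>x. norm (f x) powr p))"

text \<open>
  Weak gradients are tested against \<open>C\<^sup>1\<^sub>0(\<Omega>)\<close>, as in Gilbarg and Trudinger. The
  integrals are vector valued, so this comprises all partial derivatives at once.
\<close>

definition weak_gradient ::
  "(real ^ 'n) set \<Rightarrow> (real ^ 'n \<Rightarrow> real) \<Rightarrow> (real ^ 'n \<Rightarrow> real ^ 'n) \<Rightarrow> bool" where
  "weak_gradient \<Omega> u Du \<longleftrightarrow>
     Lp_loc 1 \<Omega> u \<and> Lp_loc 1 \<Omega> Du \<and>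
     (\<forall>\<phi> D\<phi>. C1_0 \<Omega> \<phi> D\<phi> \<longrightarrow>
        (LINT x|lebesgue_on \<Omega>. u x *\<^sub>R D\<phi> x) = - (LINT x|lebesgue_on \<Omega>. \<phi> x *\<^sub>R Du x))"

text \<open>\<open>u \<in> W\<^sup>1\<^sup>,\<^sup>p\<^sub>l\<^sub>o\<^sub>c(\<Omega>)\<close>, with weak gradient \<open>Du\<close> (unique almost everywhere).\<close>

definition W1p_loc ::
  "real \<Rightarrow> (real ^ 'n) set \<Rightarrow> (real ^ 'n \<Rightarrow> real) \<Rightarrow> (real ^ 'n \<Rightarrow> real ^ 'n) \<Rightarrow> bool" where
  "W1p_loc p \<Omega> u Du \<longleftrightarrow> weak_gradient \<Omega> u Du \<and> Lp_loc p \<Omega> u \<and> Lp_loc p \<Omega> Du"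

text \<open>
  Weak solutions of \<open>- \<Delta>\<^sub>p u + \<Lambda> u\<^sub>+\<^sup>q = 0\<close> in \<open>\<Omega>\<close>, \<open>u = g\<close> on \<open>\<partial>\<Omega>\<close>, where
  \<open>\<Lambda>\<close> is the bounded weight \<open>\<lambda>\<^sub>0\<close>. The function \<open>u\<close> is
  the continuous representative, and the boundary values are attained continuously.
  Since \<open>0 powr 0 = 0\<close>, the term \<open>max (u x) 0 powr q\<close> is the indicator of \<open>{u > 0}\<close>
  when \<open>q = 0\<close>; for \<open>p = 2\<close> the factor \<open>norm (Du x) powr 0\<close> is 1 except where
  \<open>Du x = 0\<close>, so that \<open>norm (Du x) powr 0 *\<^sub>R Du x = Du x\<close> throughout.
\<close>

definition weak_solution ::
  "real \<Rightarrow> real \<Rightarrow> (real ^ 'n) set \<Rightarrow> (real ^ 'n \<Rightarrow> real) \<Rightarrow> (real ^ 'n \<Rightarrow> real) \<Rightarrow>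
    (real ^ 'n \<Rightarrow> real) \<Rightarrow> bool" where
  "weak_solution p q \<Omega> \<Lambda> g u \<longleftrightarrow>
     (\<exists>Du. W1p_loc p \<Omega> u Du \<and>
       (\<forall>\<phi> D\<phi>. C1_0 \<Omega> \<phi> D\<phi> \<and> (\<forall>x. 0 \<le> \<phi> x) \<longrightarrow>
          (LINT x|lebesgue_on \<Omega>. (norm (Du x) powr (p - 2) *\<^sub>R Du x) \<bullet> D\<phi> x) =
          - (LINT x|lebesgue_on \<Omega>. \<Lambda> x * max (u x) 0 powr q * \<phi> x))) \<and>
     continuous_on (closure \<Omega>) u \<and> (\<forall>x\<in>frontier \<Omega>. u x = g x)"

end

theory Submission imports Defs begin

text \<open>
  The idea is comparison with a radial barrier. For \<open>\<alpha> = p / (p - 1 - q)\<close> let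
  \<open>\<Psi> x = C |x - c|\<^sup>\<alpha>\<close>. A computation gives \<open>\<Delta>\<^sub>p \<Psi> = \<kappa> |x - c|\<^sup>\<alpha>\<^sup>q\<close> with \<open>\<kappa> = (C \<alpha>)\<^sup>p\<^sup>-\<^sup>1 (N + \<alpha> q)\<close>, while
  \<open>\<Psi>\<^sup>q = C\<^sup>q |x - c|\<^sup>\<alpha>\<^sup>q\<close> for \<open>x \<noteq> c\<close>. The powers of the distance agree, and since \<open>q < p - 1\<close> a small \<open>C\<close>, depending
  only on \<open>N\<close>, \<open>p\<close>, \<open>q\<close> and \<open>m\<close>, makes \<open>\<kappa> < m C\<^sup>q\<close> (\<open>barrier_constant_exists\<close>), so that \<open>\<Psi>\<close> is a strict
  supersolution. If \<open>u < C r\<^sup>\<alpha>\<close> on the sphere around \<open>x0\<close>, choose \<open>c\<close> so close to \<open>x0\<close> that \<open>u c > 0\<close> and still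
  \<open>u < \<Psi>\<close> on the sphere. Comparison in the ball yields \<open>u c \<le> \<Psi> c = 0\<close>, a contradiction.

  The comparison principle (\<open>barrier_comparison\<close>) would follow at once from testing both equations with
  \<open>((u - \<Psi> - \<delta>)\<^sub>+)\<^sup>2\<close> and the monotonicity of \<open>v \<mapsto> |v|\<^sup>p\<^sup>-\<^sup>2 v\<close> (\<open>pLaplace_monotone\<close>), but this function is only
  weakly differentiable, whereas test functions are \<open>C\<^sup>1\<close>. Therefore \<open>u\<close> is replaced inside the test function
  by a \<open>C\<^sup>1\<close> approximation \<open>v\<close>. The resulting error is at most a constant times
  \<open>\<integral> (1 + |Du|)\<^sup>p\<^sup>-\<^sup>1 |Dv - Du|\<close> over the ball, which \<open>smooth_approximation\<close> makes arbitrarily small by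
  mollification.

  The weak form of the equation for \<open>\<Psi>\<close> is an integration by parts for the homogeneous field
  \<open>|x - c|\<^sup>\<beta> (x - c)\<close>; it is obtained by differentiating a dilated integral (\<open>euler_identity\<close>).
\<close>

section \<open>Elementary inequalities\<close>

text \<open>
  A form of the Young inequality with the weight \<open>t\<close> kept explicit: if \<open>a \<le> t * s\<close> the first term
  dominates, otherwise \<open>s \<le> a / t\<close> and the second does.
\<close>

lemma powr_young:
  fixes s a t p :: real
  assumes "0 \<le> s" "0 \<le> a" "0 < t" "1 < p"
  shows "s powr (p - 1) * a \<le> t * s powr p + t powr (1 - p) * a powr p"
proof (cases "a \<le> t * s")
  case True
  have "s powr (p - 1) * a \<le> s powr (p - 1) * (t * s)"
    using True by (intro mult_left_mono) auto
  also have "\<dots> = t * s powr p"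
    using assms(1) by (cases "s = 0") (auto simp: powr_diff)
  also have "\<dots> \<le> t * s powr p + t powr (1 - p) * a powr p" by simp
  finally show ?thesis .
next
  case False
  then have a: "s \<le> a / t" "0 < a" using assms by (auto simp: field_simps intro: le_less_trans[of 0 "t * s"])
  have "s powr (p - 1) * a \<le> (a / t) powr (p - 1) * a"
    using a assms by (intro mult_right_mono powr_mono2) auto
  also have "\<dots> = t powr (1 - p) * a powr p"
    using a assms by (simp add: powr_divide powr_diff powr_minus field_simps)
  also have "\<dots> \<le> t * s powr p + t powr (1 - p) * a powr p" using assms by simp
  finally show ?thesis .
qed

lemma powr_add_le:
  fixes a b p :: real
  assumes "0 \<le> a" "0 \<le> b" "0 \<le> p"
  shows "(a + b) powr p \<le> 2 powr p * (a powr p + b powr p)"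
proof -
  have "(a + b) powr p \<le> (2 * max a b) powr p"
    using assms by (intro powr_mono2) auto
  also have "\<dots> = 2 powr p * max a b powr p" using assms by (simp add: powr_mult)
  also have "\<dots> \<le> 2 powr p * (a powr p + b powr p)"
    by (intro mult_left_mono) (auto simp: max_def)
  finally show ?thesis .
qed

lemma square_pos_part_lipschitz:
  fixes s t Y e :: real
  assumes "\<bar>s - t\<bar> \<le> e" "s \<le> Y" "t \<le> Y" "0 \<le> Y"
  shows "\<bar>(max 0 s)\<^sup>2 - (max 0 t)\<^sup>2\<bar> \<le> 2 * Y * e"
proof -
  have "(max 0 s)\<^sup>2 - (max 0 t)\<^sup>2 = (max 0 s + max 0 t) * (max 0 s - max 0 t)"
    by (simp add: power2_eq_square algebra_simps)
  then have "\<bar>(max 0 s)\<^sup>2 - (max 0 t)\<^sup>2\<bar> = (max 0 s + max 0 t) * \<bar>max 0 s - max 0 t\<bar>"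
    by (simp add: abs_mult)
  also have "\<dots> \<le> (2 * Y) * e"
    using assms by (intro mult_mono) auto
  finally show ?thesis .
qed

section \<open>Calculus and integration preliminaries\<close>

lemma DERIV_square_pos_part:
  "((\<lambda>t::real. (max 0 t)^2) has_real_derivative 2 * max 0 t) (at t)"
proof -
  consider "t < 0" | "t > 0" | "t = 0" by linarith
  then show ?thesis
  proof cases
    case 1
    have "((\<lambda>t::real. 0) has_real_derivative 0) (at t)" by simp
    then have "((\<lambda>t::real. (max 0 t)^2) has_real_derivative 0) (at t)"
      by (rule has_field_derivative_transform_within_open[where S="{..<0}"]) (use 1 in auto)
    with 1 show ?thesis by simp
  next
    case 2
    have "((\<lambda>t::real. t^2) has_real_derivative 2 * t) (at t)"
      by (auto intro!: derivative_eq_intros)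
    then have "((\<lambda>t::real. (max 0 t)^2) has_real_derivative 2 * t) (at t)"
      by (rule has_field_derivative_transform_within_open[where S="{0<..}"]) (use 2 in auto)
    with 2 show ?thesis by simp
  next
    case 3
    have "((\<lambda>h. ((max 0 (0 + h))\<^sup>2 - (max 0 0)\<^sup>2) / h) \<longlongrightarrow> 0) (at (0::real))"
    proof (rule Lim_null_comparison[where g="\<lambda>h. \<bar>h\<bar>"])
      show "\<forall>\<^sub>F h in at (0::real). norm (((max 0 (0 + h))\<^sup>2 - (max 0 0)\<^sup>2) / h) \<le> \<bar>h\<bar>"
        by (rule always_eventually) (auto simp: max_def power2_eq_square)
      show "((\<lambda>h. \<bar>h\<bar>) \<longlongrightarrow> 0) (at (0::real))"
        by (intro tendsto_eq_intros) auto
    qed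
    with 3 show ?thesis by (simp add: DERIV_def)
  qed
qed

lemma GDERIV_continuous_on:
  assumes "\<And>x. GDERIV f x :> Df x"
  shows "continuous_on S f"
  using assms unfolding gderiv_def
  by (meson continuous_at_imp_continuous_on has_derivative_continuous)

lemma lborel_integral_affine:
  fixes f :: "'a::euclidean_space \<Rightarrow> real"
  assumes "c \<noteq> 0" and [measurable]: "f \<in> borel_measurable borel"
  shows "(LINT x|lborel. f (t + c *\<^sub>R x)) = (LINT x|lborel. f x) / \<bar>c\<bar> ^ DIM('a)"
proof -
  have "(LINT x|lborel. f x) = (LINT x|density (distr lborel borel (\<lambda>x. t + c *\<^sub>R x)) (\<lambda>_. ennreal (\<bar>c\<bar>^DIM('a))). f x)"
    by (subst lborel_affine[OF assms(1), of t]) (rule refl)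
  also have "\<dots> = \<bar>c\<bar>^DIM('a) * (LINT x|lborel. f (t + c *\<^sub>R x))"
    by (simp add: integral_density integral_distr)
  finally show ?thesis using assms(1) by simp
qed

lemma lebesgue_on_support:
  fixes f :: "'a::euclidean_space \<Rightarrow> 'b::euclidean_space"
  assumes "S \<subseteq> T" "S \<in> sets lebesgue" "T \<in> sets lebesgue" "\<And>x. x \<in> T - S \<Longrightarrow> f x = 0"
  shows "integrable (lebesgue_on T) f \<longleftrightarrow> integrable (lebesgue_on S) f"
    and "(LINT x|lebesgue_on T. f x) = (LINT x|lebesgue_on S. f x)"
proof -
  have *: "(\<lambda>x. if x \<in> T then f x else 0) = (\<lambda>x. if x \<in> S then f x else 0)"
    using assms by fastforce
  show "integrable (lebesgue_on T) f \<longleftrightarrow> integrable (lebesgue_on S) f"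
    using assms by (simp add: * flip: Lebesgue_Measure.integrable_restrict_UNIV)
  show "(LINT x|lebesgue_on T. f x) = (LINT x|lebesgue_on S. f x)"
    using assms by (simp add: * flip: Lebesgue_Measure.integral_restrict_UNIV)
qed

section \<open>Mollifiers\<close>

text \<open>
  Class \<open>C\<^sup>1\<close> suffices, because the translates of the kernel only serve as test functions and to
  produce \<open>C\<^sup>1\<close> functions by convolution.
\<close>

definition mollifier :: "real \<Rightarrow> ('a::euclidean_space \<Rightarrow> real) \<Rightarrow> ('a \<Rightarrow> 'a) \<Rightarrow> bool" where
  "mollifier \<epsilon> \<rho> D\<rho> \<longleftrightarrow>
     (\<forall>z. 0 \<le> \<rho> z) \<and> (\<forall>z. GDERIV \<rho> z :> D\<rho> z) \<and> continuous_on UNIV D\<rho> \<and>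
     (\<forall>z. \<epsilon> \<le> norm z \<longrightarrow> \<rho> z = 0 \<and> D\<rho> z = 0) \<and> (\<forall>z. \<rho> (- z) = \<rho> z) \<and>
     integrable lborel \<rho> \<and> (LINT z|lborel. \<rho> z) = 1"

lemma mollifier_exists:
  assumes "0 < \<epsilon>"
  obtains \<rho> :: "'a::euclidean_space \<Rightarrow> real" and D\<rho> where "mollifier \<epsilon> \<rho> D\<rho>"
proof -
  \<comment> \<open>An explicit \<open>C\<^sup>1\<close> bump; its normalising constant need not be computed.\<close>
  define k where "k z = (max 0 (\<epsilon>\<^sup>2 - z \<bullet> z))\<^sup>2" for z :: 'a
  have cont: "continuous_on S k" for S unfolding k_def by (intro continuous_intros)
  have pos: "max 0 (\<epsilon>\<^sup>2 - z \<bullet> z) = 0" if "\<epsilon> \<le> norm z" for z :: 'a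
    using that assms power_mono[of \<epsilon> "norm z" 2]
    by (auto simp: power2_norm_eq_inner[symmetric])
  then have zero: "k z = 0" if "\<epsilon> \<le> norm z" for z
    using that by (simp add: k_def)
  have int: "integrable lborel k"
  proof -
    have "integrable lborel (\<lambda>x. indicator (cball (0::'a) \<epsilon>) x *\<^sub>R k x)"
      by (rule borel_integrable_compact) (auto intro: cont)
    then show ?thesis
      by (rule Bochner_Integration.integrable_cong[THEN iffD1, rotated -1])
         (auto simp: indicator_def zero)
  qed
  define c where "c = (LINT z|lborel. k z)"
  have "c \<ge> 0" unfolding c_def by (rule integral_nonneg_AE) (simp add: k_def)
  moreover have "c \<noteq> 0"
  proof
    assume "c = 0"
    then have "AE z in lborel. k z = 0"
      using integral_nonneg_eq_0_iff_AE[OF int] unfolding c_def by (auto simp: k_def[abs_def])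
    then have "AE z in lborel. z \<notin> ball (0::'a) \<epsilon>"
    proof eventually_elim
      case (elim z)
      show ?case
      proof
        assume "z \<in> ball 0 \<epsilon>"
        then have "norm z < \<epsilon>" by simp
        then have "z \<bullet> z < \<epsilon>\<^sup>2" using power_strict_mono[of "norm z" \<epsilon> 2]
          by (simp add: power2_norm_eq_inner)
        with elim show False by (simp add: k_def)
      qed
    qed
    then have "ball (0::'a) \<epsilon> \<in> null_sets lborel"
      by (simp add: AE_iff_null_sets)
    then have "negligible (ball (0::'a) \<epsilon>)"
      by (simp add: negligible_iff_null_sets null_sets_completionI)
    then show False using assms open_not_negligible[of "ball (0::'a) \<epsilon>"] by simp
  qed
  ultimately have c: "c > 0" by simp
  define D where "D z = (- 4 * max 0 (\<epsilon>\<^sup>2 - z \<bullet> z) / c) *\<^sub>R z" for z :: 'a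
  have "GDERIV (\<lambda>z. k z / c) z :> D z" for z
  proof -
    have 1: "GDERIV (\<lambda>z::'a. \<epsilon>\<^sup>2 - z \<bullet> z) z :> - 2 *\<^sub>R z"
      unfolding gderiv_def
      by (auto intro!: derivative_eq_intros simp: inner_commute algebra_simps)
    have 2: "((\<lambda>t::real. (max 0 t)^2 / c) has_real_derivative 2 * max 0 t / c) (at t)" for t
      using DERIV_cdivide[OF DERIV_square_pos_part] .
    show ?thesis
      using GDERIV_DERIV_compose[OF 1 2] by (simp add: k_def D_def)
  qed
  moreover have "continuous_on UNIV D"
    unfolding D_def using c by (intro continuous_intros) auto
  moreover have "integrable lborel (\<lambda>z. k z / c)" "(LINT z|lborel. k z / c) = 1"
    using int c by (auto simp: c_def)
  moreover have "D z = 0" if "\<epsilon> \<le> norm z" for z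
    using pos[OF that] by (simp add: D_def)
  ultimately have "mollifier \<epsilon> (\<lambda>z. k z / c) D"
    unfolding mollifier_def using c zero by (auto simp: k_def)
  then show ?thesis by (rule that)
qed

lemma mollifier_integral:
  fixes x :: "'a::euclidean_space"
  assumes "mollifier \<epsilon> \<rho> D\<rho>"
  shows "integrable lborel (\<lambda>y. \<rho> (x - y))" and "(LINT y|lborel. \<rho> (x - y)) = 1"
proof -
  have [measurable]: "\<rho> \<in> borel_measurable borel"
    using assms by (auto simp: mollifier_def intro!: borel_measurable_continuous_onI GDERIV_continuous_on)
  show *: "(LINT y|lborel. \<rho> (x - y)) = 1"
    using lborel_integral_affine[of "-1" \<rho> x] assms by (simp add: mollifier_def)
  then show "integrable lborel (\<lambda>y. \<rho> (x - y))"
    using not_integrable_integral_eq by fastforce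
qed

text \<open>
  Fubini. Since \<open>b\<close> is only Lebesgue measurable, it is first replaced by a Borel function that agrees
  with it almost everywhere.
\<close>

lemma mollifier_preserves_integral:
  fixes b :: "'a::euclidean_space \<Rightarrow> real"
  assumes \<rho>: "mollifier \<epsilon> \<rho> D\<rho>" and b: "integrable lebesgue b"
  shows "integrable lebesgue (\<lambda>x. LINT y|lebesgue. \<rho> (x - y) * b y)"
    and "(LINT x|lebesgue. LINT y|lebesgue. \<rho> (x - y) * b y) = (LINT y|lebesgue. b y)"
proof -
  have cont: "continuous_on UNIV \<rho>" and \<rho>0: "\<And>z. \<rho> z \<ge> 0" and ev: "\<And>z. \<rho> (-z) = \<rho> z"
    using \<rho> by (auto simp: mollifier_def intro: GDERIV_continuous_on)
  have [measurable]: "\<rho> \<in> borel_measurable borel"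
    by (rule borel_measurable_continuous_onI[OF cont])
  have \<rho>x: "integrable lborel (\<lambda>x. \<rho> (x - y))" "(LINT x|lborel. \<rho> (x - y)) = 1" for y
  proof -
    have "\<rho> (x - y) = \<rho> (y - x)" for x using ev[of "x - y"] by simp
    then show "integrable lborel (\<lambda>x. \<rho> (x - y))" "(LINT x|lborel. \<rho> (x - y)) = 1"
      using mollifier_integral[OF \<rho>, of y] by simp_all
  qed
  obtain b' where b'[measurable]: "b' \<in> borel_measurable lborel" and ae: "AE x in lborel. b x = b' x"
    using completion_ex_borel_measurable_real[OF borel_measurable_integrable[OF b]] by auto
  have ae': "AE x in lebesgue. b x = b' x" using ae by (rule AE_completion)
  have bm[measurable]: "b \<in> borel_measurable lebesgue" using b by auto
  have b'm[measurable]: "b' \<in> borel_measurable lebesgue" using b' by (simp add: measurable_completion)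
  have "integrable lebesgue b'"
    using b ae' by (subst integrable_cong_AE[where g=b]) auto
  then have b'i: "integrable lborel b'" using b' by (simp add: integrable_completion)
  have inner: "(LINT y|lebesgue. \<rho> (x - y) * b y) = (LINT y|lborel. \<rho> (x - y) * b' y)" for x
  proof -
    have [measurable]: "(\<lambda>y. \<rho> (x - y)) \<in> borel_measurable lebesgue"
      by (intro measurable_completion) simp
    have "(LINT y|lebesgue. \<rho> (x - y) * b y) = (LINT y|lebesgue. \<rho> (x - y) * b' y)"
      using ae' by (intro integral_cong_AE) auto
    also have "\<dots> = (LINT y|lborel. \<rho> (x - y) * b' y)"
      by (rule integral_completion) measurable
    finally show ?thesis .
  qed
  have prod: "integrable (lborel \<Otimes>\<^sub>M lborel) (\<lambda>(y, x). \<rho> (x - y) * b' y)"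
  proof (rule lborel_pair.Fubini_integrable)
    show "integrable lborel (\<lambda>y. LINT x|lborel. norm (case (y, x) of (y, x) \<Rightarrow> \<rho> (x - y) * b' y))"
      using b'i \<rho>0 by (simp add: abs_mult \<rho>x)
  qed (auto simp: \<rho>x)
  have int: "integrable lborel (\<lambda>x. LINT y|lborel. \<rho> (x - y) * b' y)"
    using lborel_pair.integrable_snd[OF prod] by simp
  then show "integrable lebesgue (\<lambda>x. LINT y|lebesgue. \<rho> (x - y) * b y)"
    unfolding inner by (simp add: integrable_completion borel_measurable_integrable)
  have "(LINT x|lebesgue. LINT y|lebesgue. \<rho> (x - y) * b y)
      = (LINT x|lborel. LINT y|lborel. \<rho> (x - y) * b' y)"
    unfolding inner by (rule integral_completion) (use int in auto)
  also have "\<dots> = (LINT y|lborel. LINT x|lborel. \<rho> (x - y) * b' y)"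
    using lborel_pair.Fubini_integral[OF prod] by simp
  also have "\<dots> = (LINT y|lborel. b' y)" by (simp add: \<rho>x)
  also have "\<dots> = (LINT y|lebesgue. b' y)" by (rule integral_completion[symmetric]) simp
  also have "\<dots> = (LINT y|lebesgue. b y)" using ae' by (intro integral_cong_AE) auto
  finally show "(LINT x|lebesgue. LINT y|lebesgue. \<rho> (x - y) * b y) = (LINT y|lebesgue. b y)" .
qed

lemma GDERIV_convolution:
  fixes \<rho> :: "'a::euclidean_space \<Rightarrow> real"
  assumes d: "\<And>z. GDERIV \<rho> z :> D\<rho> z" and c: "continuous_on UNIV D\<rho>"
    and w: "continuous_on UNIV w"
  shows "GDERIV (\<lambda>x. integral (cbox a b) (\<lambda>y. w y * \<rho> (x - y))) x :>
      integral (cbox a b) (\<lambda>y. w y *\<^sub>R D\<rho> (x - y))"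
    and "continuous_on UNIV (\<lambda>x. integral (cbox a b) (\<lambda>y. w y *\<^sub>R D\<rho> (x - y)))"
proof -
  note [continuous_intros] = continuous_on_compose2[OF c _ subset_UNIV]
    continuous_on_compose2[OF w _ subset_UNIV]
    continuous_on_compose2[OF GDERIV_continuous_on[OF d] _ subset_UNIV]
  define fx where "fx x y = blinfun_inner_left (w y *\<^sub>R D\<rho> (x - y))" for x y
  have der: "((\<lambda>x. w y * \<rho> (x - y)) has_derivative blinfun_apply (fx x y)) (at x within UNIV)" for x y
  proof -
    have "(\<rho> has_derivative (\<lambda>h. h \<bullet> D\<rho> (x - y))) (at (x - y))"
      using d unfolding gderiv_def .
    then have "((\<lambda>x. \<rho> (x - y)) has_derivative (\<lambda>h. h \<bullet> D\<rho> (x - y))) (at x)"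
      by (rule has_derivative_compose[rotated]) (auto intro!: derivative_eq_intros)
    then have "((\<lambda>x. w y * \<rho> (x - y)) has_derivative (\<lambda>h. w y * (h \<bullet> D\<rho> (x - y)))) (at x)"
      by (rule has_derivative_mult_right)
    then show ?thesis
      by (rule has_derivative_eq_rhs) (auto simp: fx_def fun_eq_iff)
  qed
  have cfx: "continuous_on (UNIV \<times> cbox a b) (\<lambda>(x, y). fx x y)"
    unfolding fx_def case_prod_beta
    by (intro bounded_linear.continuous_on[OF bounded_linear_blinfun_inner_left] continuous_intros)
  have "((\<lambda>x. integral (cbox a b) (\<lambda>y. w y * \<rho> (x - y))) has_derivative
      blinfun_apply (integral (cbox a b) (fx x))) (at x within UNIV)"
    by (rule leibniz_rule[OF der _ cfx]) (auto intro!: integrable_continuous continuous_intros)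
  moreover have "blinfun_apply (integral (cbox a b) (fx x)) h
      = h \<bullet> integral (cbox a b) (\<lambda>y. w y *\<^sub>R D\<rho> (x - y))" for h
  proof -
    have "continuous_on (cbox a b) (fx x)"
      unfolding fx_def
      by (intro bounded_linear.continuous_on[OF bounded_linear_blinfun_inner_left] continuous_intros)
    then have "blinfun_apply (integral (cbox a b) (fx x)) h = integral (cbox a b) (\<lambda>y. fx x y h)"
      by (intro blinfun_apply_integral integrable_continuous)
    also have "\<dots> = integral (cbox a b) ((\<lambda>v. h \<bullet> v) \<circ> (\<lambda>y. w y *\<^sub>R D\<rho> (x - y)))"
      by (simp add: fx_def o_def)
    also have "\<dots> = h \<bullet> integral (cbox a b) (\<lambda>y. w y *\<^sub>R D\<rho> (x - y))"
      by (intro integral_linear integrable_continuous continuous_intros bounded_linear_inner_right)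
    finally show ?thesis .
  qed
  ultimately show "GDERIV (\<lambda>x. integral (cbox a b) (\<lambda>y. w y * \<rho> (x - y))) x :>
      integral (cbox a b) (\<lambda>y. w y *\<^sub>R D\<rho> (x - y))"
    unfolding gderiv_def by (auto intro: has_derivative_eq_rhs)
  show "continuous_on UNIV (\<lambda>x. integral (cbox a b) (\<lambda>y. w y *\<^sub>R D\<rho> (x - y)))"
    by (rule integral_continuous_on_param) (auto simp: case_prod_beta intro!: continuous_intros)
qed

lemma C1_0_mollifier_translate:
  fixes x :: "real ^ 'n"
  assumes \<rho>: "mollifier \<epsilon> \<rho> D\<rho>" and sub: "cball x \<epsilon> \<subseteq> \<Omega>"
  shows "C1_0 \<Omega> (\<lambda>y. \<rho> (x - y)) (\<lambda>y. - D\<rho> (x - y))"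
proof -
  have "GDERIV (\<lambda>y. \<rho> (x - y)) y :> - D\<rho> (x - y)" for y
  proof -
    have "(\<rho> has_derivative (\<lambda>h. h \<bullet> D\<rho> (x - y))) (at (x - y))"
      using \<rho> unfolding mollifier_def gderiv_def by blast
    then have "((\<lambda>y. \<rho> (x - y)) has_derivative (\<lambda>h. (- h) \<bullet> D\<rho> (x - y))) (at y)"
      by (rule has_derivative_compose[rotated]) (auto intro!: derivative_eq_intros)
    then show ?thesis unfolding gderiv_def by simp
  qed
  moreover have "continuous_on UNIV D\<rho>" using \<rho> by (simp add: mollifier_def)
  then have "continuous_on UNIV (\<lambda>y. - D\<rho> (x - y))"
    by (intro continuous_on_minus continuous_on_compose2[of UNIV D\<rho> UNIV "\<lambda>y. x - y"] continuous_on_diff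
      continuous_on_const continuous_on_id) auto
  moreover have "{y. \<rho> (x - y) \<noteq> 0} \<subseteq> cball x \<epsilon>"
  proof
    fix y assume "y \<in> {y. \<rho> (x - y) \<noteq> 0}"
    then have "\<not> \<epsilon> \<le> norm (x - y)" using \<rho> by (auto simp: mollifier_def)
    then show "y \<in> cball x \<epsilon>" by (simp add: dist_norm)
  qed
  then have cl: "closure {y. \<rho> (x - y) \<noteq> 0} \<subseteq> cball x \<epsilon>" by (simp add: closure_minimal)
  then have "compact (closure {y. \<rho> (x - y) \<noteq> 0})"
    using bounded_subset[OF bounded_cball cl] by (simp add: compact_eq_bounded_closed)
  ultimately show ?thesis unfolding C1_0_def using cl sub by auto
qed

section \<open>Density of continuous functions in Lebesgue spaces\<close>

text \<open>
  Radial retraction onto the ball of radius \<open>M\<close>.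
\<close>

definition truncate :: "real \<Rightarrow> 'a::real_normed_vector \<Rightarrow> 'a" where
  "truncate M v = (1 / max 1 (norm v / M)) *\<^sub>R v"

lemma
  fixes v :: "'a::real_normed_vector" and S :: "'a set"
  assumes "0 < M"
  shows truncate_id: "norm v \<le> M \<Longrightarrow> truncate M v = v"
    and norm_truncate: "norm (truncate M v) \<le> M"
    and norm_diff_truncate: "norm (v - truncate M v) \<le> norm v"
    and continuous_on_truncate: "continuous_on S (truncate M)"
proof -
  show "truncate M v = v" if "norm v \<le> M"
    using that assms by (simp add: truncate_def max_def field_simps)
  show "norm (truncate M v) \<le> M"
    using assms by (auto simp: truncate_def max_def field_simps)
  let ?k = "1 / max 1 (norm v / M)"
  have "0 \<le> ?k" "?k \<le> 1" by (auto simp: divide_simps)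
  have "v - truncate M v = (1 - ?k) *\<^sub>R v" by (simp add: truncate_def scaleR_left_diff_distrib)
  then show "norm (v - truncate M v) \<le> norm v"
    using \<open>0 \<le> ?k\<close> \<open>?k \<le> 1\<close> by (simp add: mult_left_le_one_le)
  show "continuous_on S (truncate M)"
    unfolding truncate_def using assms by (intro continuous_intros) auto
qed

text \<open>
  Truncation makes the function bounded at a small cost in \<open>L\<^sup>p\<close>; a bounded function on a compact set
  is then approximated by dominated convergence.
\<close>

lemma continuous_dense_Lp:
  fixes f :: "'a::euclidean_space \<Rightarrow> 'b::euclidean_space"
  assumes K: "compact K" and f: "f \<in> borel_measurable (lebesgue_on K)"
    and fp: "integrable (lebesgue_on K) (\<lambda>x. norm (f x) powr p)" and p: "1 \<le> p" and e: "0 < e"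
  obtains h where "continuous_on UNIV h"
    and "integrable (lebesgue_on K) (\<lambda>x. norm (f x - h x) powr p)"
    and "(LINT x|lebesgue_on K. norm (f x - h x) powr p) < e"
proof -
  let ?L = "lebesgue_on K"
  have Ks: "K \<in> sets lebesgue" using K by (simp add: compact_imp_closed)
  have tm: "truncate M \<in> borel_measurable borel" if "0 < M" for M :: real
    by (rule borel_measurable_continuous_onI[OF continuous_on_truncate[OF that]])
  have fin: "finite_measure ?L"
    using K by (intro finite_measure_lebesgue_on lmeasurable_compact)
  define e' where "e' = e / (2 * 2 powr p)"
  have e': "e' > 0" using e by (simp add: e'_def)
  define T where "T n = (\<lambda>x. truncate (real (Suc n)) (f x))" for n
  have Tm: "T n \<in> borel_measurable ?L" for n
    unfolding T_def by (rule measurable_compose[OF f tm]) simp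
  have "(\<lambda>n. LINT x|?L. norm (f x - T n x) powr p) \<longlonglongrightarrow> (LINT x|?L. 0)"
  proof (rule integral_dominated_convergence[OF _ _ fp])
    show "AE x in ?L. (\<lambda>n. norm (f x - T n x) powr p) \<longlonglongrightarrow> 0"
    proof (rule AE_I2)
      fix x
      have "\<forall>\<^sub>F n in sequentially. norm (f x) \<le> real (Suc n)"
        using eventually_ge_at_top[of "nat \<lceil>norm (f x)\<rceil>"] by eventually_elim linarith
      then have "\<forall>\<^sub>F n in sequentially. norm (f x - T n x) powr p = 0"
        by eventually_elim (simp add: T_def truncate_id)
      then show "(\<lambda>n. norm (f x - T n x) powr p) \<longlonglongrightarrow> 0" by (rule tendsto_eventually)
    qed
    show "AE x in ?L. norm (norm (f x - T n x) powr p) \<le> norm (f x) powr p" for n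
      using p by (auto simp: T_def intro!: powr_mono2 norm_diff_truncate)
  qed (use f Tm in auto)
  then have "\<forall>\<^sub>F n in sequentially. (LINT x|?L. norm (f x - T n x) powr p) < e'"
    using e' by (intro order_tendstoD) auto
  then obtain n where n: "(LINT x|?L. norm (f x - T n x) powr p) < e'"
    by (auto simp: eventually_sequentially)
  have i1: "integrable ?L (\<lambda>x. norm (f x - T n x) powr p)"
    by (rule Bochner_Integration.integrable_bound[OF fp])
       (use f Tm p in \<open>auto simp: T_def intro!: powr_mono2 norm_diff_truncate\<close>)
  \<comment> \<open>A measurable function is almost everywhere a limit of continuous ones, and truncating these
     at the same level provides the bound for dominated convergence.\<close>
  define M where "M = real (Suc n)"
  have M: "M > 0" by (simp add: M_def)
  have "(\<lambda>x. if x \<in> K then f x else 0) \<in> borel_measurable lebesgue"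
    using f Ks by (simp add: borel_measurable_if)
  then have "(\<lambda>x. if x \<in> K then f x else 0) measurable_on UNIV"
    by (rule lebesgue_measurable_imp_measurable_on) simp
  then obtain N g where N: "negligible N" and g: "\<And>k. continuous_on UNIV (g k)"
    and lim: "\<And>x. x \<notin> N \<Longrightarrow> (\<lambda>k. g k x) \<longlonglongrightarrow> (if x \<in> K then f x else 0)"
    unfolding measurable_on_def by auto
  define h where "h k = (\<lambda>x. truncate M (g k x))" for k
  have hc: "continuous_on UNIV (h k)" for k
    unfolding h_def by (rule continuous_on_compose2[OF continuous_on_truncate[OF M] g]) auto
  have hm: "h k \<in> borel_measurable ?L" for k
    by (intro measurable_restrict_space1 measurable_completion)
       (simp add: borel_measurable_continuous_onI[OF hc])
  have bnd: "norm (norm (T n x - h k x) powr p) \<le> (2 * M) powr p" for x k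
  proof -
    have "norm (T n x - h k x) \<le> 2 * M"
      using norm_truncate[OF M, of "f x"] norm_truncate[OF M, of "g k x"]
        norm_triangle_ineq4[of "T n x" "h k x"]
      unfolding T_def h_def M_def[symmetric] by linarith
    then show ?thesis using p by (auto intro!: powr_mono2)
  qed
  have cint: "integrable ?L (\<lambda>x. (2 * M) powr p)"
    using fin by (simp add: finite_measure.integrable_const)
  have "(\<lambda>k. LINT x|?L. norm (T n x - h k x) powr p) \<longlonglongrightarrow> (LINT x|?L. 0)"
  proof (rule integral_dominated_convergence[OF _ _ cint])
    have "AE x in lebesgue. x \<notin> N"
      using N by (simp add: negligible_iff_null_sets AE_not_in)
    then have "AE x in ?L. x \<notin> N"
      using Ks by (simp add: AE_restrict_space_iff) (auto elim: eventually_mono)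
    then show "AE x in ?L. (\<lambda>k. norm (T n x - h k x) powr p) \<longlonglongrightarrow> 0"
    proof (rule AE_mp, intro AE_I2 impI)
      fix x assume "x \<in> space ?L" "x \<notin> N"
      then have "(\<lambda>k. g k x) \<longlonglongrightarrow> f x" using lim[of x] by (simp add: space_restrict_space)
      then have "(\<lambda>k. h k x) \<longlonglongrightarrow> T n x"
        unfolding h_def T_def M_def
        using continuous_on_tendsto_compose[OF continuous_on_truncate[of "real (Suc n)" UNIV]] by simp
      from tendsto_norm[OF tendsto_diff[OF tendsto_const this, of "T n x"]]
      have "(\<lambda>k. norm (T n x - h k x)) \<longlonglongrightarrow> 0" by simp
      then show "(\<lambda>k. norm (T n x - h k x) powr p) \<longlonglongrightarrow> 0"
        using p by (intro tendsto_zero_powrI[where b=p]) auto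
    qed
  qed (use Tm hm bnd in auto)
  then have "\<forall>\<^sub>F k in sequentially. (LINT x|?L. norm (T n x - h k x) powr p) < e'"
    using e' by (intro order_tendstoD) auto
  then obtain k where k: "(LINT x|?L. norm (T n x - h k x) powr p) < e'"
    by (auto simp: eventually_sequentially)
  have i2: "integrable ?L (\<lambda>x. norm (T n x - h k x) powr p)"
    by (rule Bochner_Integration.integrable_bound[OF cint]) (use Tm hm bnd in auto)
  have i3: "integrable ?L (\<lambda>x. 2 powr p * (norm (f x - T n x) powr p + norm (T n x - h k x) powr p))"
    using i1 i2 by simp
  have le: "norm (f x - h k x) powr p
      \<le> 2 powr p * (norm (f x - T n x) powr p + norm (T n x - h k x) powr p)" for x
  proof -
    have "norm (f x - h k x) \<le> norm (f x - T n x) + norm (T n x - h k x)"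
      using norm_triangle_ineq[of "f x - T n x" "T n x - h k x"] by simp
    then show ?thesis
      using p by (intro order_trans[OF powr_mono2 powr_add_le]) auto
  qed
  have i: "integrable ?L (\<lambda>x. norm (f x - h k x) powr p)"
    by (rule Bochner_Integration.integrable_bound[OF i3]) (use f hm le in auto)
  have "(LINT x|?L. norm (f x - h k x) powr p)
      \<le> (LINT x|?L. 2 powr p * (norm (f x - T n x) powr p + norm (T n x - h k x) powr p))"
    by (rule integral_mono[OF i i3 le])
  also have "\<dots> < 2 powr p * (e' + e')" using n k i1 i2 by simp
  also have "\<dots> = e" by (simp add: e'_def)
  finally show ?thesis using that[OF hc i] by simp
qed

section \<open>Smooth approximation of Sobolev functions\<close>

text \<open>
  Convolution with a fine mollifier. The error of the gradient is measured with the weight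
  \<open>(1 + |Du|)\<^sup>p\<^sup>-\<^sup>1\<close> since it will be paired with the flux \<open>|Du|\<^sup>p\<^sup>-\<^sup>2 Du\<close>. On the smaller ball the gradient
  of the convolution is an average of \<open>Du\<close>, and averages are close to \<open>Du\<close> because \<open>Du\<close> is close in
  \<open>L\<^sup>p\<close> to a uniformly continuous field.
\<close>

lemma smooth_approximation:
  fixes u :: "real ^ 'n \<Rightarrow> real"
  assumes W: "W1p_loc p \<Omega> u Du" and p: "1 < p" and \<Omega>: "open \<Omega>"
    and uc: "continuous_on (cball x0 R) u" and r: "0 < r" "r < R" and sub: "cball x0 R \<subseteq> \<Omega>"
    and \<eta>: "0 < \<eta>"
  obtains v Dv where "\<And>x. GDERIV v x :> Dv x" "continuous_on UNIV Dv"
    and "\<And>x. x \<in> cball x0 r \<Longrightarrow> \<bar>v x - u x\<bar> \<le> \<eta>"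
    and "integrable (lebesgue_on (cball x0 r)) (\<lambda>x. (1 + norm (Du x)) powr (p - 1) * norm (Dv x - Du x))"
    and "(LINT x|lebesgue_on (cball x0 r). (1 + norm (Du x)) powr (p - 1) * norm (Dv x - Du x)) \<le> \<eta>"
proof -
  define K where "K = cball x0 R"
  define B where "B = cball x0 r"
  have K: "compact K" "K \<subseteq> \<Omega>" "B \<subseteq> K" using r sub by (auto simp: K_def B_def)
  have Ks: "K \<in> sets lebesgue" and Bs: "B \<in> sets lebesgue" and \<Omega>s: "\<Omega> \<in> sets lebesgue"
    using \<Omega> by (auto simp: K_def B_def)
  interpret LK: finite_measure "lebesgue_on K"
    using K by (intro finite_measure_lebesgue_on lmeasurable_compact)
  have L1: "Lp_loc 1 \<Omega> u" "Lp_loc 1 \<Omega> Du" and Lp: "Lp_loc p \<Omega> Du"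
    using W by (auto simp: W1p_loc_def weak_gradient_def)
  have Dum: "Du \<in> borel_measurable (lebesgue_on K)"
    using Lp K unfolding Lp_loc_def by (auto intro: measurable_restrict_mono)
  have Dup: "integrable (lebesgue_on K) (\<lambda>x. norm (Du x) powr p)"
    using Lp K unfolding Lp_loc_def by blast
  have "integrable (lebesgue_on K) (\<lambda>x. norm (Du x) powr 1)"
    using L1(2) K unfolding Lp_loc_def by blast
  then have Dui: "integrable (lebesgue_on K) Du"
    by (rule Bochner_Integration.integrable_bound) (use Dum in auto)
  define s where "s x = 1 + norm (Du x)" for x
  have s: "1 \<le> s x" for x by (simp add: s_def)
  have sm: "s \<in> borel_measurable (lebesgue_on K)" unfolding s_def using Dum by measurable
  have sp: "integrable (lebesgue_on K) (\<lambda>x. s x powr p)"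
  proof (rule Bochner_Integration.integrable_bound)
    show "integrable (lebesgue_on K) (\<lambda>x. 2 powr p * (1 powr p + norm (Du x) powr p))"
      using Dup by (intro integrable_mult_right Bochner_Integration.integrable_add) auto
    show "AE x in lebesgue_on K. norm (s x powr p) \<le> norm (2 powr p * (1 powr p + norm (Du x) powr p))"
      using p powr_add_le[of 1 "norm (Du x)" p for x] by (auto simp: s_def)
  qed (use sm in measurable)
  define S where "S = (LINT x|lebesgue_on K. s x powr p)"
  have S: "0 \<le> S" unfolding S_def by (rule integral_nonneg_AE) simp
  \<comment> \<open>The error will be at most \<open>(2 * \<tau> + \<omega>) * S + 2 * T * e\<close>, where \<open>e\<close> bounds the \<open>p\<close>-th power of
     the distance from \<open>Du\<close> to a continuous field \<open>h\<close>, and \<open>\<omega>\<close> the oscillation of \<open>h\<close> at scale \<open>\<epsilon>\<close>.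
     Dividing by \<open>S + 1\<close> covers \<open>S = 0\<close>.\<close>
  define \<omega> where "\<omega> = \<eta> / (3 * (S + 1))"
  define \<tau> where "\<tau> = \<omega> / 2"
  have \<tau>: "0 < \<tau>" and \<omega>: "0 < \<omega>" using S \<eta> by (auto simp: \<tau>_def \<omega>_def intro!: divide_pos_pos mult_pos_pos)
  define T where "T = \<tau> powr (1 - p)"
  have T: "0 < T" using \<tau> by (simp add: T_def)
  define e where "e = \<eta> / (6 * T)"
  have e: "0 < e" using T \<eta> by (simp add: e_def)
  obtain h where hc: "continuous_on UNIV h"
    and ap: "integrable (lebesgue_on K) (\<lambda>x. norm (Du x - h x) powr p)"
    and E: "(LINT x|lebesgue_on K. norm (Du x - h x) powr p) < e"
    using continuous_dense_Lp[OF K(1) Dum Dup _ e] p by auto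
  define a where "a x = norm (Du x - h x)" for x
  obtain \<delta>1 where \<delta>1: "0 < \<delta>1" "\<And>x y. x \<in> K \<Longrightarrow> y \<in> K \<Longrightarrow> dist y x < \<delta>1 \<Longrightarrow> dist (h y) (h x) < \<omega>"
    using compact_uniformly_continuous[OF continuous_on_subset[OF hc] K(1)] \<omega>
    unfolding uniformly_continuous_on_def by (metis subset_UNIV)
  obtain \<delta>2 where \<delta>2: "0 < \<delta>2" "\<And>x y. x \<in> K \<Longrightarrow> y \<in> K \<Longrightarrow> dist y x < \<delta>2 \<Longrightarrow> dist (u y) (u x) < \<eta>"
    using compact_uniformly_continuous[OF uc] \<eta> unfolding uniformly_continuous_on_def K_def
    by (metis compact_cball)
  define \<epsilon> where "\<epsilon> = min (R - r) (min \<delta>1 \<delta>2)"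
  have \<epsilon>: "0 < \<epsilon>" using r \<delta>1(1) \<delta>2(1) by (simp add: \<epsilon>_def)
  obtain \<rho> :: "real ^ 'n \<Rightarrow> real" and D\<rho> where \<rho>: "mollifier \<epsilon> \<rho> D\<rho>"
    using mollifier_exists[OF \<epsilon>] by blast
  have \<rho>0: "\<And>z. 0 \<le> \<rho> z" and \<rho>d: "\<And>z. GDERIV \<rho> z :> D\<rho> z" and \<rho>Dc: "continuous_on UNIV D\<rho>"
    and \<rho>z: "\<And>z. \<epsilon> \<le> norm z \<Longrightarrow> \<rho> z = 0 \<and> D\<rho> z = 0"
    using \<rho> by (auto simp: mollifier_def)
  have \<rho>c: "continuous_on UNIV \<rho>" by (rule GDERIV_continuous_on[OF \<rho>d])
  obtain M where M: "\<And>z. \<rho> z \<le> M" "0 \<le> M"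
  proof -
    have "bounded (\<rho> ` cball 0 \<epsilon>)"
      by (intro compact_imp_bounded compact_continuous_image continuous_on_subset[OF \<rho>c]) auto
    then obtain M where M: "\<forall>z\<in>cball 0 \<epsilon>. norm (\<rho> z) \<le> M"
      unfolding bounded_iff by blast
    have "norm (\<rho> 0) \<le> M" using M \<epsilon> by simp
    then have "0 \<le> M" by (rule order_trans[OF norm_ge_zero])
    moreover have "\<rho> z \<le> M" for z
      using bspec[OF M, of z] \<rho>z[of z] \<rho>0[of z] \<open>0 \<le> M\<close> by (cases "norm z \<le> \<epsilon>") (auto simp: dist_norm)
    ultimately show ?thesis using that by blast
  qed
  have near: "y \<in> K \<and> dist y x < \<epsilon>" if "x \<in> B" "norm (x - y) < \<epsilon>" for x y
  proof -
    have "dist x0 y \<le> dist x0 x + dist x y" by (rule dist_triangle)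
    then show ?thesis using that by (auto simp: K_def B_def \<epsilon>_def dist_norm norm_minus_commute)
  qed
  have off: "\<rho> (x - y) = 0" "D\<rho> (x - y) = 0" if "x \<in> B" "y \<notin> K" for x y
    using near[OF that(1)] that(2) \<rho>z[of "x - y"] by (auto simp: not_less[symmetric])
  obtain b where b: "K \<subseteq> cbox (-b) b"
    using bounded_subset_cbox_symmetric[OF compact_imp_bounded[OF K(1)]] by blast
  \<comment> \<open>Differentiation under the integral sign works on boxes, but a box between the two balls
     need not exist. So \<open>u\<close> is extended continuously from \<open>K\<close> to a large box; near \<open>B\<close> the
     kernel only sees values in \<open>K\<close>.\<close>
  define w where "w = u \<circ> closest_point K"
  have wc: "continuous_on UNIV w"
  proof -
    have "K \<noteq> {}" using r by (simp add: K_def)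
    then show ?thesis unfolding w_def
      using uc unfolding K_def
      by (intro continuous_on_compose continuous_on_closest_point continuous_on_subset[OF uc])
         (auto intro: closest_point_in_set)
  qed
  have wK: "w y = u y" if "y \<in> K" for y
    using that by (simp add: w_def closest_point_self)
  define v where "v x = integral (cbox (-b) b) (\<lambda>y. w y * \<rho> (x - y))" for x
  define Dv where "Dv x = integral (cbox (-b) b) (\<lambda>y. w y *\<^sub>R D\<rho> (x - y))" for x
  have vd: "GDERIV v x :> Dv x" for x
    unfolding v_def Dv_def by (rule GDERIV_convolution[OF \<rho>d \<rho>Dc wc])
  have Dvc: "continuous_on UNIV Dv"
    unfolding Dv_def by (rule GDERIV_convolution[OF \<rho>d \<rho>Dc wc])
  have \<rho>xc: "continuous_on A (\<lambda>y. \<rho> (x - y))" for x A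
    by (rule continuous_on_compose2[OF \<rho>c]) (auto intro!: continuous_intros)
  have D\<rho>xc: "continuous_on A (\<lambda>y. D\<rho> (x - y))" for x A
    by (rule continuous_on_compose2[OF \<rho>Dc]) (auto intro!: continuous_intros)
  have \<rho>xm: "(\<lambda>y. \<rho> (x - y)) \<in> borel_measurable (lebesgue_on A)" for x A
    by (intro measurable_restrict_space1 measurable_completion)
       (simp add: borel_measurable_continuous_onI[OF \<rho>xc])
  have wcc: "continuous_on A w" for A using wc by (rule continuous_on_subset) simp
  have mult_int: "integrable (lebesgue_on K) (\<lambda>y. \<rho> (x - y) *\<^sub>R f y)"
    if "integrable (lebesgue_on K) f" for x and f :: "real ^ 'n \<Rightarrow> 'b::euclidean_space"
  proof (rule Bochner_Integration.integrable_bound)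
    show "integrable (lebesgue_on K) (\<lambda>y. M * norm (f y))" using that by auto
    show "AE y in lebesgue_on K. norm (\<rho> (x - y) *\<^sub>R f y) \<le> norm (M * norm (f y))"
      using M \<rho>0 by (auto intro!: mult_right_mono)
  qed (use that \<rho>xm in auto)
  have \<rho>1: "(LINT y|lebesgue_on K. \<rho> (x - y)) = 1" if "x \<in> B" for x
  proof -
    have "(LINT y|lebesgue_on K. \<rho> (x - y)) = (LINT y|lebesgue_on UNIV. \<rho> (x - y))"
      using Ks off[OF that] by (intro lebesgue_on_support(2)[symmetric]) auto
    also have "\<dots> = (LINT y|lborel. \<rho> (x - y))"
      unfolding lebesgue_on_UNIV_eq
      by (rule integral_completion) (simp add: borel_measurable_continuous_onI[OF \<rho>xc])
    also have "\<dots> = 1" by (rule mollifier_integral[OF \<rho>])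
    finally show ?thesis .
  qed
  have box: "integral (cbox (-b) b) f = (LINT y|lebesgue_on K. f y)"
    if "continuous_on UNIV f" "\<And>y. y \<notin> K \<Longrightarrow> f y = 0" for f :: "real ^ 'n \<Rightarrow> 'b::euclidean_space"
  proof -
    have "integral (cbox (-b) b) f = (LINT y|lebesgue_on (cbox (-b) b). f y)"
      using that(1) by (intro lebesgue_integral_eq_integral[symmetric] continuous_imp_integrable)
        (auto intro: continuous_on_subset)
    also have "\<dots> = (LINT y|lebesgue_on K. f y)"
      using Ks b that(2) by (intro lebesgue_on_support) auto
    finally show ?thesis .
  qed
  have v: "v x = (LINT y|lebesgue_on K. \<rho> (x - y) * u y)" if "x \<in> B" for x
  proof -
    have "v x = (LINT y|lebesgue_on K. w y * \<rho> (x - y))"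
      unfolding v_def using off[OF that] by (intro box continuous_intros wcc \<rho>xc) auto
    also have "\<dots> = (LINT y|lebesgue_on K. \<rho> (x - y) * u y)"
      by (rule Bochner_Integration.integral_cong) (auto simp: wK)
    finally show ?thesis .
  qed
  \<comment> \<open>Here the weak gradient enters: the translated kernel is an admissible test function.\<close>
  have Dv: "Dv x = (LINT y|lebesgue_on K. \<rho> (x - y) *\<^sub>R Du y)" if "x \<in> B" for x
  proof -
    have "cball x \<epsilon> \<subseteq> K"
    proof
      fix y assume "y \<in> cball x \<epsilon>"
      moreover have "dist x0 y \<le> dist x0 x + dist x y" by (rule dist_triangle)
      ultimately show "y \<in> K" using that by (auto simp: K_def B_def \<epsilon>_def)
    qed
    then have "C1_0 \<Omega> (\<lambda>y. \<rho> (x - y)) (\<lambda>y. - D\<rho> (x - y))"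
      using K by (intro C1_0_mollifier_translate[OF \<rho>]) auto
    then have "(LINT y|lebesgue_on \<Omega>. u y *\<^sub>R - D\<rho> (x - y)) = - (LINT y|lebesgue_on \<Omega>. \<rho> (x - y) *\<^sub>R Du y)"
      using W unfolding W1p_loc_def weak_gradient_def by blast
    moreover have "(LINT y|lebesgue_on \<Omega>. u y *\<^sub>R - D\<rho> (x - y)) = (LINT y|lebesgue_on K. u y *\<^sub>R - D\<rho> (x - y))"
      using Ks \<Omega>s K off[OF that] by (intro lebesgue_on_support) auto
    moreover have "\<dots> = - (LINT y|lebesgue_on K. u y *\<^sub>R D\<rho> (x - y))" by simp
    moreover have "(LINT y|lebesgue_on \<Omega>. \<rho> (x - y) *\<^sub>R Du y) = (LINT y|lebesgue_on K. \<rho> (x - y) *\<^sub>R Du y)"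
      using Ks \<Omega>s K off[OF that] by (intro lebesgue_on_support) auto
    moreover have "Dv x = (LINT y|lebesgue_on K. w y *\<^sub>R D\<rho> (x - y))"
      unfolding Dv_def using off[OF that] by (intro box continuous_intros wcc D\<rho>xc) auto
    moreover have "\<dots> = (LINT y|lebesgue_on K. u y *\<^sub>R D\<rho> (x - y))"
      by (rule Bochner_Integration.integral_cong) (auto simp: wK)
    ultimately show ?thesis by simp
  qed
  have close: "\<bar>v x - u x\<bar> \<le> \<eta>" if x: "x \<in> B" for x
  proof -
    have ui: "integrable (lebesgue_on K) u"
    proof -
      have "integrable (lebesgue_on K) (\<lambda>x. norm (u x) powr 1)"
        using L1(1) K unfolding Lp_loc_def by blast
      then show ?thesis
        by (rule Bochner_Integration.integrable_bound)
           (use L1(1) K in \<open>auto simp: Lp_loc_def intro: measurable_restrict_mono\<close>)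
    qed
    have i0: "integrable (lebesgue_on K) (\<lambda>y. \<rho> (x - y) * c)" for c
      using mult_int[of "\<lambda>_. c" x] by simp
    have "v x - u x = (LINT y|lebesgue_on K. \<rho> (x - y) * u y) - (LINT y|lebesgue_on K. \<rho> (x - y) * u x)"
      using v[OF x] \<rho>1[OF x] by simp
    also have "\<dots> = (LINT y|lebesgue_on K. \<rho> (x - y) * u y - \<rho> (x - y) * u x)"
      using mult_int[OF ui, of x] i0 by (intro Bochner_Integration.integral_diff[symmetric]) auto
    also have "\<bar>\<dots>\<bar> \<le> (LINT y|lebesgue_on K. \<rho> (x - y) * \<eta>)"
    proof (rule order_trans[OF integral_abs_bound])
      show "(LINT y|lebesgue_on K. \<bar>\<rho> (x - y) * u y - \<rho> (x - y) * u x\<bar>) \<le> (LINT y|lebesgue_on K. \<rho> (x - y) * \<eta>)"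
      proof (rule integral_mono)
        fix y assume "y \<in> space (lebesgue_on K)"
        then have y: "y \<in> K" by simp
        show "\<bar>\<rho> (x - y) * u y - \<rho> (x - y) * u x\<bar> \<le> \<rho> (x - y) * \<eta>"
        proof (cases "norm (x - y) < \<epsilon>")
          case True
          then have "dist y x < \<delta>2" using near[OF x True] by (simp add: \<epsilon>_def)
          then have "\<bar>u y - u x\<bar> \<le> \<eta>"
            using \<delta>2(2)[of x y] x y K by (auto simp: dist_real_def)
          then show ?thesis
            using \<rho>0 by (simp add: right_diff_distrib[symmetric] abs_mult mult_left_mono)
        next
          case False
          then show ?thesis using \<rho>z[of "x - y"] by simp
        qed
      qed (use mult_int[OF ui, of x] i0 in auto)
    qed
    also have "\<dots> = \<eta>" using \<rho>1[OF x] by simp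
    finally show ?thesis .
  qed
  define bb where "bb y = (if y \<in> K then a y powr p else 0)" for y
  define Q where "Q x = (LINT y|lebesgue. \<rho> (x - y) * bb y)" for x
  have bbi: "integrable lebesgue bb"
    unfolding bb_def using ap Ks by (subst Lebesgue_Measure.integrable_restrict_UNIV) (auto simp: a_def)
  have bb0: "0 \<le> bb y" for y by (simp add: bb_def)
  have Q0: "0 \<le> Q x" for x unfolding Q_def using \<rho>0 bb0 by (intro integral_nonneg_AE) auto
  have QK: "Q x = (LINT y|lebesgue_on K. \<rho> (x - y) * a y powr p)" for x
  proof -
    have "Q x = (LINT y|lebesgue. (if y \<in> K then \<rho> (x - y) * a y powr p else 0))"
      unfolding Q_def bb_def by (rule Bochner_Integration.integral_cong) auto
    then show ?thesis using Ks by (simp add: Lebesgue_Measure.integral_restrict_UNIV)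
  qed
  have Qi: "integrable lebesgue Q" and Qe: "(LINT x|lebesgue. Q x) = (LINT y|lebesgue. bb y)"
    unfolding Q_def using mollifier_preserves_integral[OF \<rho> bbi] by auto
  have bbe: "(LINT y|lebesgue. bb y) = (LINT y|lebesgue_on K. a y powr p)"
    unfolding bb_def using Ks by (rule Lebesgue_Measure.integral_restrict_UNIV)
  \<comment> \<open>Split \<open>Du y - Du x\<close> through \<open>h y\<close> and \<open>h x\<close>; the Young inequality separates the weight at \<open>x\<close>
     from the error at \<open>y\<close>, so that only \<open>Q\<close> still couples the two points.\<close>
  define rhs where "rhs x = (2 * \<tau> + \<omega>) * s x powr p + T * a x powr p + T * Q x" for x
  have ptw: "s x powr (p - 1) * norm (Dv x - Du x) \<le> rhs x" if x: "x \<in> B" for x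
  proof -
    have i0: "integrable (lebesgue_on K) (\<lambda>y. \<rho> (x - y) * c)" for c
      using mult_int[of "\<lambda>_. c" x] by simp
    have i1: "integrable (lebesgue_on K) (\<lambda>y. \<rho> (x - y) *\<^sub>R (Du y - Du x))"
      using Dui by (intro mult_int Bochner_Integration.integrable_diff) auto
    have i2: "integrable (lebesgue_on K) (\<lambda>y. \<rho> (x - y) * a y powr p)"
      using mult_int[OF ap, of x] by (simp add: a_def)
    have "Dv x - Du x = (LINT y|lebesgue_on K. \<rho> (x - y) *\<^sub>R Du y) - (LINT y|lebesgue_on K. \<rho> (x - y) *\<^sub>R Du x)"
      using Dv[OF x] \<rho>1[OF x] i0[of 1] by simp
    also have "\<dots> = (LINT y|lebesgue_on K. \<rho> (x - y) *\<^sub>R (Du y - Du x))"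
      using mult_int[OF Dui, of x] i0[of 1]
      by (subst Bochner_Integration.integral_diff[symmetric]) (auto simp: scaleR_diff_right)
    finally have "norm (Dv x - Du x) \<le> (LINT y|lebesgue_on K. norm (\<rho> (x - y) *\<^sub>R (Du y - Du x)))"
      by (simp only: integral_norm_bound)
    then have "s x powr (p - 1) * norm (Dv x - Du x)
        \<le> s x powr (p - 1) * (LINT y|lebesgue_on K. norm (\<rho> (x - y) *\<^sub>R (Du y - Du x)))"
      by (rule mult_left_mono) simp
    also have "\<dots> = (LINT y|lebesgue_on K. s x powr (p - 1) * norm (\<rho> (x - y) *\<^sub>R (Du y - Du x)))"
      by simp
    also have "\<dots> \<le> (LINT y|lebesgue_on K. \<rho> (x - y) * ((2 * \<tau> + \<omega>) * s x powr p + T * a x powr p)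
        + T * (\<rho> (x - y) * a y powr p))"
    proof (rule integral_mono)
      fix y assume "y \<in> space (lebesgue_on K)"
      then have y: "y \<in> K" by simp
      show "s x powr (p - 1) * norm (\<rho> (x - y) *\<^sub>R (Du y - Du x))
          \<le> \<rho> (x - y) * ((2 * \<tau> + \<omega>) * s x powr p + T * a x powr p) + T * (\<rho> (x - y) * a y powr p)"
      proof (cases "norm (x - y) < \<epsilon>")
        case True
        then have "dist y x < \<delta>1" using near[OF x True] by (simp add: \<epsilon>_def)
        then have hh: "norm (h y - h x) \<le> \<omega>"
          using \<delta>1(2)[of x y] x y K by (auto simp: dist_norm)
        have "norm (Du y - Du x) \<le> a y + \<omega> + a x"
          using hh norm_triangle_ineq[of "Du y - h y" "h y - Du x"]
            norm_triangle_ineq4[of "h y - h x" "Du x - h x"]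
          by (simp add: a_def)
        then have "s x powr (p - 1) * norm (Du y - Du x) \<le> s x powr (p - 1) * (a y + \<omega> + a x)"
          by (rule mult_left_mono) simp
        also have "\<dots> = s x powr (p - 1) * a y + s x powr (p - 1) * a x + \<omega> * s x powr (p - 1)"
          by (simp add: algebra_simps)
        also have "\<dots> \<le> (\<tau> * s x powr p + T * a y powr p) + (\<tau> * s x powr p + T * a x powr p) + \<omega> * s x powr p"
          unfolding T_def
        proof (intro add_mono powr_young mult_left_mono powr_mono)
          show "0 \<le> s x" using s[of x] by linarith
          then show "0 \<le> s x" .
        qed (use s[of x] \<tau> \<omega> p in \<open>auto simp: a_def\<close>)
        finally have "s x powr (p - 1) * norm (Du y - Du x)
            \<le> (2 * \<tau> + \<omega>) * s x powr p + T * a x powr p + T * a y powr p"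
          by (simp add: algebra_simps)
        from mult_left_mono[OF this \<rho>0[of "x - y"]] show ?thesis
          using \<rho>0[of "x - y"] by (simp add: algebra_simps flip: scaleR_diff_right)
      next
        case False
        then show ?thesis using \<rho>z[of "x - y"] by simp
      qed
    qed (intro Bochner_Integration.integrable_add integrable_mult_right integrable_norm i1 i2 i0)+
    also have "\<dots> = rhs x"
      using i0 i2 \<rho>1[OF x] by (simp add: rhs_def QK)
    finally show ?thesis .
  qed
  have KB: "integrable (lebesgue_on B) f" if "integrable (lebesgue_on K) f" for f :: "real ^ 'n \<Rightarrow> real"
  proof -
    have "integrable lebesgue (\<lambda>x. if x \<in> K then f x else 0)"
      using that Ks by (simp add: Lebesgue_Measure.integrable_restrict_UNIV)
    then have "integrable lebesgue (\<lambda>x. indicator B x *\<^sub>R (if x \<in> K then f x else 0))"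
      using Bs by (rule integrable_mult_indicator[rotated])
    moreover have "indicator B x *\<^sub>R (if x \<in> K then f x else 0) = (if x \<in> B then f x else 0)" for x
      using K(3) by (auto simp: indicator_def)
    ultimately show ?thesis
      using Bs by (simp add: Lebesgue_Measure.integrable_restrict_UNIV)
  qed
  have mono: "(LINT x|lebesgue_on B. f x) \<le> (LINT x|lebesgue_on K. f x)"
    if "integrable (lebesgue_on K) f" "\<And>x. 0 \<le> f x" for f :: "real ^ 'n \<Rightarrow> real"
    by (rule integral_mono_lebesgue_on_AE) (use that K(3) Bs Ks in auto)
  have aK: "integrable (lebesgue_on K) (\<lambda>x. a x powr p)" using ap by (simp add: a_def)
  have QB: "integrable (lebesgue_on B) Q"
    using integrable_mult_indicator[OF Bs Qi] Bs by (simp add: integrable_restrict_space)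
  have QBe: "(LINT x|lebesgue_on B. Q x) \<le> (LINT x|lebesgue_on UNIV. Q x)"
    by (rule integral_mono_lebesgue_on_AE) (use Q0 Qi Bs in \<open>auto simp: lebesgue_on_UNIV_eq\<close>)
  have rhsi: "integrable (lebesgue_on B) rhs"
    unfolding rhs_def by (intro Bochner_Integration.integrable_add integrable_mult_right KB sp aK QB)
  have lhsi: "integrable (lebesgue_on B) (\<lambda>x. s x powr (p - 1) * norm (Dv x - Du x))"
  proof (rule Bochner_Integration.integrable_bound[OF rhsi])
    have "s \<in> borel_measurable (lebesgue_on B)" "Du \<in> borel_measurable (lebesgue_on B)"
      using sm Dum K(3) by (auto intro: measurable_restrict_mono)
    moreover have "Dv \<in> borel_measurable (lebesgue_on B)"
      by (intro measurable_restrict_space1 measurable_completion)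
         (simp add: borel_measurable_continuous_onI[OF Dvc])
    ultimately show "(\<lambda>x. s x powr (p - 1) * norm (Dv x - Du x)) \<in> borel_measurable (lebesgue_on B)"
      by measurable
    show "AE x in lebesgue_on B. norm (s x powr (p - 1) * norm (Dv x - Du x)) \<le> norm (rhs x)"
      using ptw by (intro AE_I2) (fastforce simp: abs_mult)
  qed
  have "(LINT x|lebesgue_on B. s x powr (p - 1) * norm (Dv x - Du x)) \<le> (LINT x|lebesgue_on B. rhs x)"
    by (rule integral_mono[OF lhsi rhsi ptw]) simp
  also have "\<dots> = (2 * \<tau> + \<omega>) * (LINT x|lebesgue_on B. s x powr p) + T * (LINT x|lebesgue_on B. a x powr p)
      + T * (LINT x|lebesgue_on B. Q x)"
    unfolding rhs_def using KB[OF sp] KB[OF aK] QB by simp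
  also have "\<dots> \<le> (2 * \<tau> + \<omega>) * S + T * e + T * e"
  proof (intro add_mono mult_left_mono)
    show "(LINT x|lebesgue_on B. s x powr p) \<le> S" unfolding S_def by (rule mono[OF sp]) simp
    show "(LINT x|lebesgue_on B. a x powr p) \<le> e"
      using mono[OF aK] E by (simp add: a_def)
    show "(LINT x|lebesgue_on B. Q x) \<le> e"
      using QBe E unfolding lebesgue_on_UNIV_eq Qe bbe by (simp add: a_def)
  qed (use \<tau> \<omega> T in auto)
  also have "\<dots> \<le> \<eta>"
  proof -
    have "\<omega> * S = \<eta> / 3 * (S / (S + 1))" by (simp add: \<omega>_def)
    also have "\<dots> \<le> \<eta> / 3 * 1" using S \<eta> by (intro mult_left_mono) auto
    finally have "\<omega> * S \<le> \<eta> / 3" by simp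
    moreover have "2 * \<tau> = \<omega>" by (simp add: \<tau>_def)
    ultimately have "(2 * \<tau> + \<omega>) * S \<le> (2 / 3) * \<eta>" by (simp add: mult.commute)
    moreover have "T * e = \<eta> / 6" using T by (simp add: e_def)
    ultimately show ?thesis by simp
  qed
  finally show ?thesis
    using that[OF vd Dvc] close lhsi unfolding s_def B_def by blast
qed

section \<open>The field of the p-Laplacian and the radial barrier\<close>

lemma norm_pLaplace_flux:
  fixes a :: "'a::real_normed_vector"
  assumes "1 < p"
  shows "norm (norm a powr (p - 2) *\<^sub>R a) = norm a powr (p - 1)"
  using powr_add[of "norm a" "p - 2" 1] assms by (cases "a = 0") simp_all

text \<open>
  Expanding the product, the left part of
  \<open>(|a|\<^sup>p\<^sup>-\<^sup>2 + |b|\<^sup>p\<^sup>-\<^sup>2) / 2 * |a - b|\<^sup>2 + (|a|\<^sup>p\<^sup>-\<^sup>2 - |b|\<^sup>p\<^sup>-\<^sup>2) * (|a|\<^sup>2 - |b|\<^sup>2) / 2\<close> is clearly nonnegative,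
  and in the right part both factors have the same sign because \<open>p \<ge> 2\<close>.
\<close>

lemma pLaplace_monotone:
  fixes a b :: "'a::real_inner"
  assumes "2 \<le> p"
  shows "0 \<le> (norm a powr (p - 2) *\<^sub>R a - norm b powr (p - 2) *\<^sub>R b) \<bullet> (a - b)"
proof -
  let ?x = "norm a" and ?y = "norm b"
  have "0 \<le> (?x powr (p - 2) + ?y powr (p - 2)) / 2 * (norm (a - b))\<^sup>2
     + (?x powr (p - 2) - ?y powr (p - 2)) * (?x\<^sup>2 - ?y\<^sup>2) / 2"
  proof (intro add_nonneg_nonneg)
    have "0 \<le> (?x powr (p - 2) - ?y powr (p - 2)) * (?x\<^sup>2 - ?y\<^sup>2)"
    proof (cases "?x \<le> ?y")
      case True
      then show ?thesis using assms by (intro mult_nonpos_nonpos) (auto intro!: powr_mono2 power_mono)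
    next
      case False
      then show ?thesis using assms by (intro mult_nonneg_nonneg) (auto intro!: powr_mono2 power_mono)
    qed
    then show "0 \<le> (?x powr (p - 2) - ?y powr (p - 2)) * (?x\<^sup>2 - ?y\<^sup>2) / 2" by simp
  qed auto
  also have "\<dots> = (norm a powr (p - 2) *\<^sub>R a - norm b powr (p - 2) *\<^sub>R b) \<bullet> (a - b)"
    by (simp add: power2_norm_eq_inner algebra_simps inner_commute)
       (simp add: field_simps)
  finally show ?thesis .
qed

text \<open>
  At the centre the gradient is zero because the exponent exceeds \<open>1\<close>; the formula gives this value
  too, even for \<open>\<alpha> < 2\<close>, since its last factor vanishes.
\<close>

lemma GDERIV_power_barrier:
  fixes c x :: "'a::real_inner"
  assumes "1 < \<alpha>"
  shows "GDERIV (\<lambda>x. C * norm (x - c) powr \<alpha>) x :> (C * \<alpha> * norm (x - c) powr (\<alpha> - 2)) *\<^sub>R (x - c)"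
proof (cases "x = c")
  case False
  have 1: "GDERIV (\<lambda>x. norm (x - c)) x :> sgn (x - c)"
    unfolding gderiv_def using False
    by (intro has_derivative_compose[where g=norm and f="\<lambda>x. x - c", THEN has_derivative_eq_rhs])
       (auto intro!: derivative_eq_intros has_derivative_norm)
  have 2: "((\<lambda>t. C * t powr \<alpha>) has_real_derivative C * (\<alpha> * norm (x - c) powr (\<alpha> - 1))) (at (norm (x - c)))"
    using False by (auto intro!: derivative_eq_intros)
  have "norm (x - c) powr (\<alpha> - 1) = norm (x - c) powr (\<alpha> - 2) * norm (x - c)"
    using False powr_add[of "norm (x - c)" "\<alpha> - 2" 1] by simp
  then show ?thesis
    using False by (intro GDERIV_subst[OF GDERIV_DERIV_compose[OF 1 2]]) (simp add: sgn_div_norm)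
next
  case True
  have "((\<lambda>h. norm (C * norm (x + h - c) powr \<alpha> - C * norm (x - c) powr \<alpha> - 0) / norm h) \<longlongrightarrow> 0) (at 0)"
  proof (rule Lim_null_comparison)
    show "\<forall>\<^sub>F h in at 0. norm (norm (C * norm (x + h - c) powr \<alpha> - C * norm (x - c) powr \<alpha> - 0) / norm h)
        \<le> \<bar>C\<bar> * norm h powr (\<alpha> - 1)"
      using True assms by (intro always_eventually) (auto simp: abs_mult powr_diff)
    show "((\<lambda>h. \<bar>C\<bar> * norm h powr (\<alpha> - 1)) \<longlongrightarrow> 0) (at 0)"
      using assms by (auto intro!: tendsto_eq_intros tendsto_zero_powrI[where b="\<alpha> - 1"] tendsto_norm_zero)
  qed
  then show ?thesis
    using True unfolding gderiv_def has_derivative_at by simp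
qed

lemma continuous_on_power_barrier_gradient:
  fixes c :: "'a::real_inner"
  assumes "1 < \<alpha>"
  shows "continuous_on S (\<lambda>x. (C * \<alpha> * norm (x - c) powr (\<alpha> - 2)) *\<^sub>R (x - c))"
proof (rule continuous_at_imp_continuous_on, rule ballI)
  fix x
  show "isCont (\<lambda>x. (C * \<alpha> * norm (x - c) powr (\<alpha> - 2)) *\<^sub>R (x - c)) x"
  proof (cases "x = c")
    case False
    then show ?thesis by (intro continuous_intros) auto
  next
    case True
    have "((\<lambda>y. (C * \<alpha> * norm (y - c) powr (\<alpha> - 2)) *\<^sub>R (y - c)) \<longlongrightarrow> 0) (at c)"
    proof (rule Lim_null_comparison)
      show "\<forall>\<^sub>F y in at c. norm ((C * \<alpha> * norm (y - c) powr (\<alpha> - 2)) *\<^sub>R (y - c))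
          \<le> \<bar>C * \<alpha>\<bar> * norm (y - c) powr (\<alpha> - 1)"
      proof (rule always_eventually, rule allI)
        fix y
        show "norm ((C * \<alpha> * norm (y - c) powr (\<alpha> - 2)) *\<^sub>R (y - c)) \<le> \<bar>C * \<alpha>\<bar> * norm (y - c) powr (\<alpha> - 1)"
          using powr_add[of "norm (y - c)" "\<alpha> - 2" 1] by (cases "y = c") (simp_all add: abs_mult)
      qed
      have "((\<lambda>y. norm (y - c)) \<longlongrightarrow> 0) (at c)"
        by (intro tendsto_norm_zero) (auto intro!: tendsto_eq_intros)
      then show "((\<lambda>y. \<bar>C * \<alpha>\<bar> * norm (y - c) powr (\<alpha> - 1)) \<longlongrightarrow> 0) (at c)"
        using assms by (auto intro!: tendsto_mult_right_zero tendsto_zero_powrI[where b="\<alpha> - 1"])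
    qed
    then show ?thesis using True by (simp add: isCont_def)
  qed
qed

text \<open>
  For \<open>\<alpha> = p / (p - 1 - q)\<close> the relation between the exponents holds with \<open>\<beta> = \<alpha> * q\<close>. The divergence of
  the flux is then a multiple of \<open>|x - c|\<close> to the power \<open>\<alpha> * q\<close>, the same power of the distance as in the
  \<open>q\<close>-th power of the barrier.
\<close>

lemma pLaplace_flux_power_barrier:
  fixes c x :: "'a::real_inner"
  assumes "0 < C" "1 < \<alpha>" "(\<alpha> - 1) * (p - 1) = \<beta> + 1"
  defines "v \<equiv> (C * \<alpha> * norm (x - c) powr (\<alpha> - 2)) *\<^sub>R (x - c)"
  shows "norm v powr (p - 2) *\<^sub>R v = ((C * \<alpha>) powr (p - 1) * norm (x - c) powr \<beta>) *\<^sub>R (x - c)"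
proof (cases "x = c")
  case False
  define t where "t = norm (x - c)"
  have t: "t > 0" using False by (simp add: t_def)
  have C: "C * \<alpha> > 0" using assms by simp
  have "norm v = C * \<alpha> * (t powr (\<alpha> - 2) * t)" using C by (simp add: v_def t_def)
  also have "t powr (\<alpha> - 2) * t = t powr (\<alpha> - 1)" using t powr_add[of t "\<alpha> - 2" 1] by simp
  finally have "norm v powr (p - 2) = (C * \<alpha>) powr (p - 2) * t powr ((\<alpha> - 1) * (p - 2))"
    using C by (simp add: powr_mult powr_powr)
  then have "norm v powr (p - 2) * (C * \<alpha> * t powr (\<alpha> - 2))
      = ((C * \<alpha>) powr (p - 2) * (C * \<alpha>)) * (t powr ((\<alpha> - 1) * (p - 2)) * t powr (\<alpha> - 2))"
    by simp
  also have "(C * \<alpha>) powr (p - 2) * (C * \<alpha>) = (C * \<alpha>) powr (p - 1)"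
    using C powr_add[of "C * \<alpha>" "p - 2" 1] by simp
  also have "t powr ((\<alpha> - 1) * (p - 2)) * t powr (\<alpha> - 2) = t powr ((\<alpha> - 1) * (p - 2) + (\<alpha> - 2))"
    by (simp add: powr_add)
  also have "(\<alpha> - 1) * (p - 2) + (\<alpha> - 2) = \<beta>" using assms(3) by (simp add: algebra_simps)
  finally show ?thesis by (simp add: v_def t_def)
qed (simp add: v_def)

text \<open>
  Both sides are homogeneous in \<open>C\<close>, of degrees \<open>p - 1\<close> and \<open>q < p - 1\<close>, so every small \<open>C\<close> will do; the
  witness makes the left side half of the right one.
\<close>

lemma barrier_constant_exists:
  fixes p q m N :: real
  assumes "0 < p" "0 \<le> q" "q < p - 1" "0 < m" "0 < N"
  defines "\<alpha> \<equiv> p / (p - 1 - q)"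
  obtains C where "0 < C" and "(C * \<alpha>) powr (p - 1) * (N + \<alpha> * q) < m * C powr q"
proof -
  have \<alpha>: "0 < \<alpha>" using assms by simp
  define K where "K = \<alpha> powr (p - 1) * (N + \<alpha> * q)"
  have K: "0 < K" using \<alpha> assms unfolding K_def by (intro mult_pos_pos add_pos_nonneg) auto
  define C where "C = (m / (2 * K)) powr (1 / (p - 1 - q))"
  have C: "0 < C" using K assms by (simp add: C_def)
  have "C powr (p - 1 - q) = m / (2 * K)"
    using K assms by (simp add: C_def powr_powr)
  then have "C powr (p - 1) = C powr q * (m / (2 * K))"
    using powr_add[of C q "p - 1 - q"] by simp
  then have "(C * \<alpha>) powr (p - 1) * (N + \<alpha> * q) = C powr q * (m / (2 * K)) * K"
    using C \<alpha> by (simp add: powr_mult K_def)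
  also have "\<dots> = C powr q * (m / 2)" using K by simp
  also have "\<dots> < m * C powr q" using C assms by simp
  finally show ?thesis using that C by blast
qed

text \<open>
  The weak form of \<open>div (|x - c|\<^sup>\<beta> (x - c)) = (N + \<beta>) |x - c|\<^sup>\<beta>\<close>, where \<open>N\<close> is the dimension. It comes from
  the homogeneity of the weight: differentiate \<open>\<integral> |x - c|\<^sup>\<beta> \<phi> (c + s (x - c)) dx\<close> at \<open>s = 1\<close>. In this way only
  \<open>\<phi>\<close> is differentiated and never the weight, which need not be of class \<open>C\<^sup>1\<close> at \<open>c\<close>.
\<close>

lemma euler_identity:
  fixes \<phi> :: "'a::euclidean_space \<Rightarrow> real" and \<beta> :: real
  assumes d: "\<And>x. GDERIV \<phi> x :> D\<phi> x" and cD: "continuous_on UNIV D\<phi>"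
    and bd: "bounded {x. \<phi> x \<noteq> 0}" and b: "0 \<le> \<beta>"
  shows "(LINT x|lborel. norm (x - c) powr \<beta> * ((x - c) \<bullet> D\<phi> x))
       = - (DIM('a) + \<beta>) * (LINT x|lborel. norm (x - c) powr \<beta> * \<phi> x)"
proof -
  obtain R where R: "R > 0" and supp: "\<And>x. \<phi> x \<noteq> 0 \<Longrightarrow> norm (x - c) \<le> R"
  proof -
    obtain r where "{x. \<phi> x \<noteq> 0} \<subseteq> ball c r" "r > 0" using bounded_subset_ballD[OF bd] by blast
    then show ?thesis by (intro that[of r]) (auto simp: dist_norm norm_minus_commute less_imp_le subset_iff)
  qed
  have c\<phi>: "continuous_on UNIV \<phi>" by (rule GDERIV_continuous_on[OF d])
  have [measurable]: "\<phi> \<in> borel_measurable borel" "D\<phi> \<in> borel_measurable borel"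
    using c\<phi> cD by (auto intro: borel_measurable_continuous_onI)
  have "compact (D\<phi> ` cball c (2 * R))"
    by (intro compact_continuous_image continuous_on_subset[OF cD]) auto
  then obtain L where L: "\<And>x. x \<in> cball c (2 * R) \<Longrightarrow> norm (D\<phi> x) \<le> L"
    by (meson bounded_iff compact_imp_bounded imageI)
  have lip: "norm (\<phi> x - \<phi> y) \<le> L * norm (x - y)"
    if "x \<in> cball c (2 * R)" "y \<in> cball c (2 * R)" for x y
  proof (rule differentiable_bound[OF convex_cball])
    show "(\<phi> has_derivative (\<lambda>h. h \<bullet> D\<phi> z)) (at z within cball c (2 * R))"
      if "z \<in> cball c (2 * R)" for z
      using d unfolding gderiv_def by (rule has_derivative_at_withinI)
    show "onorm (\<lambda>h. h \<bullet> D\<phi> z) \<le> L" if "z \<in> cball c (2 * R)" for z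
    proof (rule onorm_le)
      fix h :: 'a
      have "norm (h \<bullet> D\<phi> z) \<le> norm h * norm (D\<phi> z)" by (simp add: Cauchy_Schwarz_ineq2)
      also have "\<dots> \<le> L * norm h" using mult_left_mono[OF L[OF that], of "norm h"] by (simp add: mult.commute)
      finally show "norm (h \<bullet> D\<phi> z) \<le> L * norm h" .
    qed
  qed (use that in auto)
  \<comment> \<open>Only steps \<open>h n > 0\<close> are taken: for \<open>s \<ge> 1\<close> the dilated functions are still supported in the
     ball of radius \<open>R\<close>, and \<open>s \<le> 2\<close> keeps their arguments where \<open>L\<close> is a Lipschitz constant.\<close>
  define h where "h n = 1 / real (Suc n)" for n
  have h: "0 < h n" "h n \<le> 1" for n by (auto simp: h_def)
  have h0: "h \<longlonglongrightarrow> 0" unfolding h_def by (rule LIMSEQ_Suc[OF lim_1_over_n])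
  define g where "g x = norm (x - c) powr \<beta> * \<phi> x" for x
  define I where "I s = (LINT x|lborel. norm (x - c) powr \<beta> * \<phi> (c + s *\<^sub>R (x - c)))" for s
  have gm[measurable]: "g \<in> borel_measurable borel" unfolding g_def by measurable
  \<comment> \<open>Dilation by \<open>s\<close> about \<open>c\<close> shows that \<open>I\<close> is a pure power of \<open>s\<close>; the identity equates two
     computations of its derivative at \<open>s = 1\<close>.\<close>
  have I: "I s = s powr (- (DIM('a) + \<beta>)) * (LINT x|lborel. g x)" if "0 < s" for s
  proof -
    have "(LINT x|lborel. g ((1 - s) *\<^sub>R c + s *\<^sub>R x)) = (LINT x|lborel. g x) / \<bar>s\<bar> ^ DIM('a)"
      by (rule lborel_integral_affine) (use that in auto)
    moreover have "g ((1 - s) *\<^sub>R c + s *\<^sub>R x) = s powr \<beta> * (norm (x - c) powr \<beta> * \<phi> (c + s *\<^sub>R (x - c)))" for x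
    proof -
      have "(1 - s) *\<^sub>R c + s *\<^sub>R x = c + s *\<^sub>R (x - c)" by (simp add: algebra_simps)
      moreover have "norm (s *\<^sub>R (x - c)) powr \<beta> = s powr \<beta> * norm (x - c) powr \<beta>"
        using that by (simp add: powr_mult)
      ultimately show ?thesis by (simp add: g_def)
    qed
    ultimately have "s powr \<beta> * I s = (LINT x|lborel. g x) / \<bar>s\<bar> ^ DIM('a)"
      by (simp add: I_def)
    moreover have "s powr (- (DIM('a) + \<beta>)) = 1 / (s powr \<beta> * s ^ DIM('a))"
      using that by (subst powr_minus) (simp add: powr_add powr_realpow divide_simps)
    ultimately show ?thesis
      using that by (simp only:) (simp add: field_simps)
  qed
  have bi: "integrable lborel (\<lambda>x. norm (x - c) powr \<beta> * \<phi> (c + s *\<^sub>R (x - c)))" if "1 \<le> s" for s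
  proof (rule integrableI_bounded_set[where A="cball c R" and B="R powr \<beta> * (L * (3 * R))"])
    show "AE x in lborel. x \<notin> cball c R \<longrightarrow> norm (x - c) powr \<beta> * \<phi> (c + s *\<^sub>R (x - c)) = 0"
    proof (intro AE_I2 impI)
      fix x assume "x \<notin> cball c R"
      then have "R < norm (x - c)" by (simp add: dist_norm norm_minus_commute)
      also have "\<dots> \<le> s * norm (x - c)" using that by (simp add: mult_le_cancel_right1)
      finally have "R < norm (s *\<^sub>R (x - c))" using that by simp
      then show "norm (x - c) powr \<beta> * \<phi> (c + s *\<^sub>R (x - c)) = 0"
        using supp[of "c + s *\<^sub>R (x - c)"] by force
    qed
    have \<phi>b: "norm (\<phi> z) \<le> L * (3 * R)" for z
    proof (cases "\<phi> z = 0")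
      case True
      have "0 \<le> L" using L[of c] R by (auto intro: order_trans[OF norm_ge_zero])
      then show ?thesis using True R by simp
    next
      case False
      then have z: "norm (z - c) \<le> R" by (rule supp)
      obtain i :: 'a where i: "i \<in> Basis" using nonempty_Basis by blast
      define y where "y = c + (2 * R) *\<^sub>R i"
      have "norm (y - c) = 2 * R" using i R by (simp add: y_def)
      then have y: "\<phi> y = 0" "y \<in> cball c (2 * R)"
        using supp[of y] R by (force, simp add: dist_norm norm_minus_commute)
      have "norm (\<phi> z - \<phi> y) \<le> L * norm (z - y)"
        using z y R by (intro lip) (auto simp: dist_norm norm_minus_commute)
      also have "\<dots> \<le> L * (3 * R)"
      proof (rule mult_left_mono)
        show "norm (z - y) \<le> 3 * R"
          using norm_triangle_ineq4[of "z - c" "y - c"] z \<open>norm (y - c) = 2 * R\<close> by simp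
        show "0 \<le> L" using L[of c] R by (auto intro: order_trans[OF norm_ge_zero])
      qed
      finally show ?thesis using y by simp
    qed
    show "AE x in lborel. x \<in> cball c R \<longrightarrow>
        norm (norm (x - c) powr \<beta> * \<phi> (c + s *\<^sub>R (x - c))) \<le> R powr \<beta> * (L * (3 * R))"
      using \<phi>b b by (auto simp: abs_mult dist_norm norm_minus_commute intro!: mult_mono powr_mono2)
  qed (use emeasure_lborel_cball_finite[of c R] in auto)
  have lim1: "(\<lambda>n. LINT x|lborel. norm (x - c) powr \<beta> * ((\<phi> (c + (1 + h n) *\<^sub>R (x - c)) - \<phi> x) / h n))
     \<longlonglongrightarrow> (LINT x|lborel. norm (x - c) powr \<beta> * ((x - c) \<bullet> D\<phi> x))"
  proof (rule integral_dominated_convergence[where w="\<lambda>x. indicator (cball c R) x * (R powr \<beta> * (L * R))"])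
    show "integrable lborel (\<lambda>x. indicat_real (cball c R) x * (R powr \<beta> * (L * R)))"
      using emeasure_lborel_cball_finite[of c R]
      by (intro integrable_mult_left integrable_real_indicator) auto
    show "AE x in lborel. (\<lambda>n. norm (x - c) powr \<beta> * ((\<phi> (c + (1 + h n) *\<^sub>R (x - c)) - \<phi> x) / h n))
       \<longlonglongrightarrow> norm (x - c) powr \<beta> * ((x - c) \<bullet> D\<phi> x)"
    proof (rule AE_I2)
      fix x
      have "((\<lambda>t. \<phi> (x + t *\<^sub>R (x - c))) has_derivative (\<lambda>t. (t *\<^sub>R (x - c)) \<bullet> D\<phi> x)) (at 0)"
        by (rule has_derivative_compose[where g=\<phi> and f="\<lambda>t. x + t *\<^sub>R (x - c)" and g'="\<lambda>h. h \<bullet> D\<phi> x"])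
           (use d in \<open>auto simp: gderiv_def intro!: derivative_eq_intros\<close>)
      then have "((\<lambda>t. \<phi> (x + t *\<^sub>R (x - c))) has_real_derivative (x - c) \<bullet> D\<phi> x) (at 0)"
        by (rule has_derivative_imp_has_field_derivative) simp
      then have "((\<lambda>t. (\<phi> (x + t *\<^sub>R (x - c)) - \<phi> x) / t) \<longlongrightarrow> (x - c) \<bullet> D\<phi> x) (at 0)"
        by (simp add: DERIV_def)
      moreover have "filterlim h (at 0) sequentially"
        using h0 h by (auto simp: filterlim_at less_imp_neq intro!: always_eventually) (metis h(1) less_irrefl)
      ultimately have "(\<lambda>n. (\<phi> (x + h n *\<^sub>R (x - c)) - \<phi> x) / h n) \<longlonglongrightarrow> (x - c) \<bullet> D\<phi> x"
        by (rule filterlim_compose)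
      moreover have "x + t *\<^sub>R (x - c) = c + (1 + t) *\<^sub>R (x - c)" for t by (simp add: algebra_simps)
      ultimately show "(\<lambda>n. norm (x - c) powr \<beta> * ((\<phi> (c + (1 + h n) *\<^sub>R (x - c)) - \<phi> x) / h n))
         \<longlonglongrightarrow> norm (x - c) powr \<beta> * ((x - c) \<bullet> D\<phi> x)"
        by (intro tendsto_mult_left) simp
    qed
    show "AE x in lborel. norm (norm (x - c) powr \<beta> * ((\<phi> (c + (1 + h n) *\<^sub>R (x - c)) - \<phi> x) / h n))
        \<le> indicat_real (cball c R) x * (R powr \<beta> * (L * R))" for n
    proof (rule AE_I2)
      fix x
      show "norm (norm (x - c) powr \<beta> * ((\<phi> (c + (1 + h n) *\<^sub>R (x - c)) - \<phi> x) / h n))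
        \<le> indicat_real (cball c R) x * (R powr \<beta> * (L * R))"
      proof (cases "x \<in> cball c R")
        case True
        then have x: "norm (x - c) \<le> R" by (simp add: dist_norm norm_minus_commute)
        have "(1 + h n) * norm (x - c) \<le> 2 * R"
          using x h[of n] by (intro mult_mono) auto
        then have "norm (\<phi> (c + (1 + h n) *\<^sub>R (x - c)) - \<phi> x) \<le> L * norm (c + (1 + h n) *\<^sub>R (x - c) - x)"
          using x R h[of n] by (intro lip) (auto simp: dist_norm norm_minus_commute)
        also have "c + (1 + h n) *\<^sub>R (x - c) - x = h n *\<^sub>R (x - c)" by (simp add: algebra_simps)
        also have "L * norm (h n *\<^sub>R (x - c)) \<le> L * (h n * R)"
          using x h[of n] L[of c] R
          by (intro mult_left_mono) (auto intro: order_trans[OF norm_ge_zero])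
        finally have "norm ((\<phi> (c + (1 + h n) *\<^sub>R (x - c)) - \<phi> x) / h n) \<le> L * R"
          using h[of n] by (simp add: field_simps)
        then have "norm (norm (x - c) powr \<beta> * ((\<phi> (c + (1 + h n) *\<^sub>R (x - c)) - \<phi> x) / h n)) \<le> R powr \<beta> * (L * R)"
          unfolding norm_mult using x b by (intro mult_mono) (auto intro!: powr_mono2)
        then show ?thesis using True by simp
      next
        case False
        then have x: "R < norm (x - c)" by (simp add: dist_norm norm_minus_commute)
        also have "\<dots> \<le> (1 + h n) * norm (x - c)" using h[of n] by (simp add: mult_le_cancel_right1)
        finally have "R < norm ((1 + h n) *\<^sub>R (x - c))" using h[of n] by simp
        then have "\<phi> (c + (1 + h n) *\<^sub>R (x - c)) = 0"
          using supp[of "c + (1 + h n) *\<^sub>R (x - c)"] by force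
        moreover have "\<phi> x = 0" using supp[of x] x by force
        ultimately show ?thesis using False by simp
      qed
    qed
  qed measurable
  have eq: "(LINT x|lborel. norm (x - c) powr \<beta> * ((\<phi> (c + (1 + h n) *\<^sub>R (x - c)) - \<phi> x) / h n))
      = (LINT x|lborel. g x) * (((1 + h n) powr (- (DIM('a) + \<beta>)) - 1) / h n)" for n
  proof -
    have "(LINT x|lborel. norm (x - c) powr \<beta> * ((\<phi> (c + (1 + h n) *\<^sub>R (x - c)) - \<phi> x) / h n))
      = (LINT x|lborel. (norm (x - c) powr \<beta> * \<phi> (c + (1 + h n) *\<^sub>R (x - c))
            - norm (x - c) powr \<beta> * \<phi> (c + 1 *\<^sub>R (x - c))) / h n)"
      by (intro Bochner_Integration.integral_cong) (auto simp: algebra_simps diff_divide_distrib)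
    also have "\<dots> = (I (1 + h n) - I 1) / h n"
      using bi[of "1 + h n"] bi[of 1] h[of n]
      by (simp add: I_def Bochner_Integration.integral_diff)
    also have "\<dots> = (LINT x|lborel. g x) * (((1 + h n) powr (- (DIM('a) + \<beta>)) - 1) / h n)"
      using h[of n] I[of "1 + h n"] I[of 1] by (simp add: field_simps)
    finally show ?thesis .
  qed
  have lim2: "(\<lambda>n. (LINT x|lborel. g x) * (((1 + h n) powr (- (DIM('a) + \<beta>)) - 1) / h n))
      \<longlonglongrightarrow> (LINT x|lborel. g x) * (- (DIM('a) + \<beta>))"
  proof (rule tendsto_mult_left)
    have "((\<lambda>s. s powr (- (DIM('a) + \<beta>))) has_real_derivative - (DIM('a) + \<beta>)) (at 1)"
      by (auto intro!: derivative_eq_intros)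
    then have "((\<lambda>t. ((1 + t) powr (- (DIM('a) + \<beta>)) - 1) / t) \<longlongrightarrow> - (DIM('a) + \<beta>)) (at 0)"
      by (simp add: DERIV_def)
    moreover have "filterlim h (at 0) sequentially"
      using h0 h by (auto simp: filterlim_at less_imp_neq intro!: always_eventually) (metis h(1) less_irrefl)
    ultimately show "(\<lambda>n. ((1 + h n) powr (- (DIM('a) + \<beta>)) - 1) / h n) \<longlonglongrightarrow> - (DIM('a) + \<beta>)"
      by (rule filterlim_compose)
  qed
  from LIMSEQ_unique[OF lim1[unfolded eq] lim2] show ?thesis
    by (simp add: g_def)
qed

section \<open>Comparison with the barrier\<close>

text \<open>
  Squaring the positive part makes it continuously differentiable, so no chain rule for weakly
  differentiable functions is involved. The compact set \<open>S\<close> contains the support.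
\<close>

lemma C1_0_square_pos_part:
  fixes w :: "real ^ 'n \<Rightarrow> real"
  assumes dw: "\<And>x. GDERIV w x :> Dw x" and cw: "continuous_on UNIV Dw"
    and S: "compact S" "S \<subseteq> U" and U: "open U" "U \<subseteq> \<Omega>"
    and neg: "\<And>x. x \<in> U - S \<Longrightarrow> w x \<le> 0"
  shows "C1_0 \<Omega> (\<lambda>x. if x \<in> U then (max 0 (w x))\<^sup>2 else 0)
      (\<lambda>x. if x \<in> U then (2 * max 0 (w x)) *\<^sub>R Dw x else 0)"
    (is "C1_0 \<Omega> ?f ?D")
proof -
  have opS: "open (- S)" using S by (simp add: compact_imp_closed open_Compl)
  have zf: "?f x = 0" and zD: "?D x = 0" if "x \<in> - S" for x
    using neg[of x] that by (auto simp: max_absorb1)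
  have cover: "UNIV = U \<union> - S" using S by auto
  have "GDERIV ?f x :> ?D x" for x
  proof (cases "x \<in> U")
    case True
    have "GDERIV (\<lambda>x. (max 0 (w x))\<^sup>2) x :> ?D x"
      using True GDERIV_DERIV_compose[OF dw DERIV_square_pos_part] by simp
    then show ?thesis
      unfolding gderiv_def
      by (rule has_derivative_transform_within_open[OF _ U(1) True]) simp
  next
    case False
    then have x: "x \<in> - S" using S by auto
    have "((\<lambda>x. 0) has_derivative (\<lambda>h. h \<bullet> ?D x)) (at x)" using zD[OF x] by simp
    then show ?thesis
      unfolding gderiv_def
      by (rule has_derivative_transform_within_open[OF _ opS x]) (metis zf)
  qed
  moreover have "continuous_on UNIV ?D"
    unfolding cover
  proof (rule continuous_on_open_Un[OF U(1) opS])
    have "continuous_on U (\<lambda>x. (2 * max 0 (w x)) *\<^sub>R Dw x)"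
      by (intro continuous_intros GDERIV_continuous_on[OF dw] continuous_on_subset[OF cw]) simp
    then show "continuous_on U ?D" by (rule continuous_on_eq) simp
    show "continuous_on (- S) ?D"
      by (rule continuous_on_eq[OF continuous_on_const[of _ 0]]) (metis zD)
  qed
  moreover have cl: "closure {x. ?f x \<noteq> 0} \<subseteq> S"
    using zf S by (intro closure_minimal compact_imp_closed) blast+
  moreover have "compact (closure {x. ?f x \<noteq> 0})"
    using bounded_subset[OF compact_imp_bounded[OF S(1)] cl] by (simp add: compact_eq_bounded_closed)
  ultimately show ?thesis unfolding C1_0_def using S U by auto
qed

text \<open>
  Suppose \<open>u\<close> exceeds the barrier \<open>\<Psi>\<close> by \<open>2 \<delta>\<close> somewhere in the ball. Testing the equation of \<open>u\<close> and
  the identity for the flux of \<open>\<Psi>\<close> with \<open>((v - \<Psi> - \<delta>)\<^sub>+)\<^sup>2\<close>, where \<open>v\<close> is a \<open>C\<^sup>1\<close> approximation of \<open>u\<close>, and letting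
  \<open>v\<close> tend to \<open>u\<close>, monotonicity leaves \<open>\<integral> (\<Lambda> (u\<^sub>+)\<^sup>q - \<kappa> |x - c|\<^sup>\<beta>) ((u - \<Psi> - \<delta>)\<^sub>+)\<^sup>2 \<le> 0\<close>. The smallness of \<open>C\<close>
  makes the first factor positive wherever \<open>u > \<Psi> + \<delta>\<close>, so this open set is a null set and hence
  empty.
\<close>

lemma barrier_comparison:
  fixes u :: "real ^ 'n \<Rightarrow> real" and p q m L C \<alpha> :: real
  assumes p: "2 \<le> p" and q: "0 \<le> q" "q < p - 1" and \<Omega>: "open \<Omega>"
    and sub: "cball x0 R \<subseteq> \<Omega>" and r: "0 < r" "r < R"
    and \<Lambda>m: "\<Lambda> \<in> borel_measurable (lebesgue_on \<Omega>)" and \<Lambda>b: "\<And>x. x \<in> \<Omega> \<Longrightarrow> \<bar>\<Lambda> x\<bar> \<le> L"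
    and \<Lambda>: "\<And>x. x \<in> \<Omega> \<Longrightarrow> m \<le> \<Lambda> x"
    and W: "W1p_loc p \<Omega> u Du" and uc: "continuous_on \<Omega> u"
    and eq: "\<And>\<phi> D\<phi>. C1_0 \<Omega> \<phi> D\<phi> \<Longrightarrow> (\<And>x. 0 \<le> \<phi> x) \<Longrightarrow>
        (LINT x|lebesgue_on \<Omega>. (norm (Du x) powr (p - 2) *\<^sub>R Du x) \<bullet> D\<phi> x)
          = - (LINT x|lebesgue_on \<Omega>. \<Lambda> x * max (u x) 0 powr q * \<phi> x)"
    and C: "0 < C" and \<alpha>: "\<alpha> = p / (p - 1 - q)"
    and Cm: "(C * \<alpha>) powr (p - 1) * (CARD('n) + \<alpha> * q) < m * C powr q"
    and bdry: "\<And>x. x \<in> sphere x0 r \<Longrightarrow> u x < C * norm (x - c) powr \<alpha>"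
    and x2: "x2 \<in> cball x0 r"
  shows "u x2 \<le> C * norm (x2 - c) powr \<alpha>"
proof (rule ccontr)
  define \<Psi> where "\<Psi> x = C * norm (x - c) powr \<alpha>" for x
  define D\<Psi> where "D\<Psi> x = (C * \<alpha> * norm (x - c) powr (\<alpha> - 2)) *\<^sub>R (x - c)" for x
  define A where "A v = norm v powr (p - 2) *\<^sub>R v" for v :: "real ^ 'n"
  define \<beta> where "\<beta> = \<alpha> * q"
  define k where "k = (C * \<alpha>) powr (p - 1)"
  define \<kappa> where "\<kappa> = k * (CARD('n) + \<beta>)"
  define B where "B = cball x0 r"
  define U where "U = ball x0 r"
  assume "\<not> u x2 \<le> C * norm (x2 - c) powr \<alpha>"
  then have x2': "u x2 > \<Psi> x2" by (simp add: \<Psi>_def)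
  define \<delta> where "\<delta> = (u x2 - \<Psi> x2) / 2"
  have \<delta>: "0 < \<delta>" using x2' by (simp add: \<delta>_def)
  have \<alpha>1: "1 < \<alpha>" using p q unfolding \<alpha> by (simp add: less_divide_eq)
  have \<alpha>\<beta>: "(\<alpha> - 1) * (p - 1) = \<beta> + 1"
    using q unfolding \<beta>_def \<alpha> by (simp add: field_simps)
  have \<beta>: "0 \<le> \<beta>" using q \<alpha>1 by (simp add: \<beta>_def)
  have \<kappa>: "\<kappa> < m * C powr q" using Cm by (simp add: \<kappa>_def k_def \<beta>_def)
  have k0: "0 < k" using C \<alpha>1 by (simp add: k_def)
  have \<kappa>0: "0 \<le> \<kappa>" using k0 \<beta> by (simp add: \<kappa>_def)
  have \<Psi>d: "GDERIV \<Psi> x :> D\<Psi> x" for x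
    unfolding \<Psi>_def D\<Psi>_def by (rule GDERIV_power_barrier[OF \<alpha>1])
  have D\<Psi>c: "continuous_on S D\<Psi>" for S
    unfolding D\<Psi>_def by (rule continuous_on_power_barrier_gradient[OF \<alpha>1])
  have \<Psi>c: "continuous_on S \<Psi>" for S by (rule GDERIV_continuous_on[OF \<Psi>d])
  have \<Psi>0: "0 \<le> \<Psi> x" for x using C by (simp add: \<Psi>_def)
  have AD\<Psi>: "A (D\<Psi> x) = (k * norm (x - c) powr \<beta>) *\<^sub>R (x - c)" for x
    unfolding A_def D\<Psi>_def k_def by (rule pLaplace_flux_power_barrier[OF C \<alpha>1 \<alpha>\<beta>])
  have B: "B \<subseteq> \<Omega>" "compact B" "U \<subseteq> B" "open U" "x2 \<in> B"
    using r sub x2 by (auto simp: B_def U_def)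
  have Bs: "B \<in> sets lebesgue" and \<Omega>s: "\<Omega> \<in> sets lebesgue" using \<Omega> by (auto simp: B_def)
  interpret LB: finite_measure "lebesgue_on B"
    using B by (intro finite_measure_lebesgue_on lmeasurable_compact)
  have bU: "x \<in> U" if "x \<in> B" "\<Psi> x \<le> u x" for x
    using that bdry[of x] by (fastforce simp: B_def U_def \<Psi>_def)
  have cB: "continuous_on B u" using uc B(1) by (rule continuous_on_subset)
  obtain Y0 where Y0: "\<And>x. x \<in> B \<Longrightarrow> \<bar>u x\<bar> \<le> Y0"
    using compact_imp_bounded[OF compact_continuous_image[OF cB B(2)]] by (auto simp: bounded_iff)
  obtain G where G: "\<And>x. x \<in> B \<Longrightarrow> norm (D\<Psi> x) \<le> G"
    using compact_imp_bounded[OF compact_continuous_image[OF D\<Psi>c B(2)]] by (auto simp: bounded_iff)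
  have G0: "0 \<le> G" and Y00: "0 \<le> Y0" using G[OF B(5)] Y0[OF B(5)] by (auto intro: order_trans[OF norm_ge_zero])
  define Y where "Y = Y0 + 1"
  have Y: "0 \<le> Y" using Y00 by (simp add: Y_def)
  obtain H where H: "\<And>x. x \<in> B \<Longrightarrow> norm (x - c) \<le> H"
  proof -
    have "bounded ((\<lambda>x. x - c) ` B)"
      using B(2) by (intro compact_imp_bounded compact_continuous_image continuous_intros)
    then show ?thesis using that by (auto simp: bounded_iff)
  qed
  have H0: "0 \<le> H" using H[OF B(5)] by (auto intro: order_trans[OF norm_ge_zero])
  define f where "f x = \<Lambda> x * max (u x) 0 powr q - \<kappa> * norm (x - c) powr \<beta>" for x
  define F where "F = L * Y0 powr q + \<kappa> * H powr \<beta>"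
  have L0: "0 \<le> L" using \<Lambda>b[of x2] B by force
  have f1b: "\<bar>\<Lambda> x * max (u x) 0 powr q\<bar> \<le> L * Y0 powr q" if "x \<in> B" for x
    unfolding abs_mult using \<Lambda>b[of x] Y0[OF that] that B Y00 L0 q
    by (intro mult_mono) (auto intro!: powr_mono2)
  have f2b: "\<bar>\<kappa> * norm (x - c) powr \<beta>\<bar> \<le> \<kappa> * H powr \<beta>" if "x \<in> B" for x
    unfolding abs_mult using H[OF that] \<kappa>0 \<beta> by (intro mult_mono) (auto intro!: powr_mono2)
  have fb: "\<bar>f x\<bar> \<le> F" if "x \<in> B" for x
    using f1b[OF that] f2b[OF that] unfolding f_def F_def by linarith
  have F0: "0 \<le> F" using fb[OF B(5)] by linarith
  have um: "u \<in> borel_measurable (lebesgue_on B)"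
    by (rule continuous_imp_measurable_on_sets_lebesgue[OF cB Bs])
  have \<Lambda>mB: "\<Lambda> \<in> borel_measurable (lebesgue_on B)"
    using \<Lambda>m B(1) by (rule measurable_restrict_mono)
  have Lp: "Lp_loc p \<Omega> Du" using W by (simp add: W1p_loc_def)
  have Dum: "Du \<in> borel_measurable (lebesgue_on B)"
    using Lp B unfolding Lp_loc_def by (auto intro: measurable_restrict_mono)
  have Dup: "integrable (lebesgue_on B) (\<lambda>x. norm (Du x) powr p)"
    using Lp B unfolding Lp_loc_def by blast
  have cm: "h \<in> borel_measurable (lebesgue_on B)" if "continuous_on UNIV h" for h :: "real ^ 'n \<Rightarrow> 'b::euclidean_space"
    using that Bs by (intro continuous_imp_measurable_on_sets_lebesgue) (auto intro: continuous_on_subset)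
  have xcm: "(\<lambda>x. x - c) \<in> borel_measurable (lebesgue_on B)" by (intro cm continuous_intros)
  have ncm: "(\<lambda>x. norm (x - c) powr \<beta>) \<in> borel_measurable (lebesgue_on B)"
    using xcm by measurable
  have f1m: "(\<lambda>x. \<Lambda> x * max (u x) 0 powr q) \<in> borel_measurable (lebesgue_on B)"
    using um \<Lambda>mB by measurable
  have fm: "f \<in> borel_measurable (lebesgue_on B)"
    unfolding f_def using f1m ncm by measurable
  have bint: "integrable (lebesgue_on B) (\<lambda>x. h x * \<phi> x)"
    if "h \<in> borel_measurable (lebesgue_on B)" "\<phi> \<in> borel_measurable (lebesgue_on B)"
      "\<And>x. x \<in> B \<Longrightarrow> \<bar>h x\<bar> \<le> X1" "\<And>x. x \<in> B \<Longrightarrow> \<bar>\<phi> x\<bar> \<le> X2"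
    for h \<phi> :: "real ^ 'n \<Rightarrow> real" and X1 X2 :: real
  proof (rule LB.integrable_const_bound[where B="X1 * X2"])
    show "AE x in lebesgue_on B. norm (h x * \<phi> x) \<le> X1 * X2"
      using mult_mono[OF that(3) that(4) order_trans[OF abs_ge_zero that(3)] abs_ge_zero]
      by (intro AE_I2) (simp add: abs_mult)
  qed (use that(1,2) in measurable)
  \<comment> \<open>The test function one would like to use. Its threshold \<open>\<delta>\<close> leaves room for an error \<open>\<eta> \<le> \<delta>\<close> in
     the approximation of \<open>u\<close>, so that the \<open>C\<^sup>1\<close> substitutes \<open>\<phi>\<close> below still vanish near the sphere.\<close>
  define \<phi>0 where "\<phi>0 x = (max 0 (u x - \<Psi> x - \<delta>))\<^sup>2" for x
  have \<phi>0m: "\<phi>0 \<in> borel_measurable (lebesgue_on B)"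
    unfolding \<phi>0_def using um cm[OF \<Psi>c] by measurable
  have \<phi>0b: "\<bar>\<phi>0 x\<bar> \<le> Y\<^sup>2" if "x \<in> B" for x
    unfolding \<phi>0_def using Y0[OF that] \<Psi>0[of x] \<delta> Y by (auto simp: Y_def intro!: power_mono)
  have f\<phi>0i: "integrable (lebesgue_on B) (\<lambda>x. f x * \<phi>0 x)"
    by (rule bint[OF fm \<phi>0m fb \<phi>0b])
  define Z where "Z = 2 * Y * (1 + G powr (p - 1)) + measure (lebesgue_on B) B * (F * (2 * Y))"
  have main: "(LINT x|lebesgue_on B. f x * \<phi>0 x) \<le> Z * \<eta>" if \<eta>: "0 < \<eta>" "\<eta> \<le> min 1 \<delta>" for \<eta>
  proof -
    obtain v Dv where vd: "\<And>x. GDERIV v x :> Dv x" and Dvc: "continuous_on UNIV Dv"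
      and vu: "\<And>x. x \<in> B \<Longrightarrow> \<bar>v x - u x\<bar> \<le> \<eta>"
      and ei: "integrable (lebesgue_on B) (\<lambda>x. (1 + norm (Du x)) powr (p - 1) * norm (Dv x - Du x))"
      and e: "(LINT x|lebesgue_on B. (1 + norm (Du x)) powr (p - 1) * norm (Dv x - Du x)) \<le> \<eta>"
    proof (rule smooth_approximation[OF W _ \<Omega> continuous_on_subset[OF uc sub] r sub \<eta>(1)])
      show "1 < p" using p by simp
    qed (use that in \<open>auto simp: B_def\<close>)
    define w where "w x = v x - \<Psi> x - \<delta>" for x
    define g where "g x = (if x \<in> U then 2 * max 0 (w x) else 0)" for x
    define \<phi> where "\<phi> x = (if x \<in> U then (max 0 (w x))\<^sup>2 else 0)" for x
    define D\<phi> where "D\<phi> x = (if x \<in> U then (2 * max 0 (w x)) *\<^sub>R (Dv x - D\<Psi> x) else 0)" for x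
    define S where "S = {x \<in> B. \<Psi> x \<le> u x}"
    have S: "compact S" "S \<subseteq> U"
    proof -
      have "S = B \<inter> {x \<in> B. \<Psi> x \<le> u x}" by (auto simp: S_def)
      moreover have "closed {x \<in> B. \<Psi> x \<le> u x}"
        using B(2) by (intro continuous_on_closed_Collect_le compact_imp_closed cB \<Psi>c)
      ultimately show "compact S" using B(2) by (metis compact_Int_closed)
      show "S \<subseteq> U" using bU by (auto simp: S_def)
    qed
    have wd: "GDERIV w x :> Dv x - D\<Psi> x" for x
      unfolding w_def using GDERIV_diff[OF GDERIV_diff[OF vd \<Psi>d] GDERIV_const] by simp
    have wY: "w x \<le> Y" if "x \<in> B" for x
      using vu[OF that] Y0[OF that] \<Psi>0[of x] \<delta> \<eta> unfolding w_def Y_def by linarith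
    have C1: "C1_0 \<Omega> \<phi> D\<phi>"
      unfolding \<phi>_def D\<phi>_def
    proof (rule C1_0_square_pos_part[OF wd _ S B(4)])
      show "continuous_on UNIV (\<lambda>x. Dv x - D\<Psi> x)" by (intro continuous_on_diff Dvc D\<Psi>c)
      show "U \<subseteq> \<Omega>" using B by blast
      fix x assume x: "x \<in> U - S"
      then have "u x < \<Psi> x" using B(3) by (auto simp: S_def)
      moreover have "\<bar>v x - u x\<bar> \<le> \<eta>" using x B(3) vu by blast
      ultimately show "w x \<le> 0" using \<eta> unfolding w_def by linarith
    qed
    have \<phi>d: "\<And>x. GDERIV \<phi> x :> D\<phi> x" and D\<phi>c: "continuous_on UNIV D\<phi>"
      using C1 by (auto simp: C1_0_def)
    have \<phi>c: "continuous_on UNIV \<phi>" by (rule GDERIV_continuous_on[OF \<phi>d])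
    have \<phi>0': "0 \<le> \<phi> x" for x by (simp add: \<phi>_def)
    have offB: "\<phi> x = 0" "D\<phi> x = 0" if "x \<notin> B" for x
      using that B(3) by (auto simp: \<phi>_def D\<phi>_def)
    have g: "0 \<le> g x" "g x \<le> 2 * Y" if "x \<in> B" for x
      using wY[OF that] Y by (auto simp: g_def)
    have D\<phi>g: "D\<phi> x = g x *\<^sub>R (Dv x - D\<Psi> x)" for x by (simp add: D\<phi>_def g_def)
    obtain X where X: "\<And>x. x \<in> B \<Longrightarrow> norm (D\<phi> x) \<le> X"
      using compact_imp_bounded[OF compact_continuous_image[OF continuous_on_subset[OF D\<phi>c] B(2)]]
      by (auto simp: bounded_iff)
    have X0: "0 \<le> X" using X[OF B(5)] by (auto intro: order_trans[OF norm_ge_zero])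
    have \<phi>b: "\<bar>\<phi> x\<bar> \<le> Y\<^sup>2" if "x \<in> B" for x
      using wY[OF that] Y by (auto simp: \<phi>_def intro!: power_mono)
    have Am: "(\<lambda>x. A (Du x) \<bullet> D\<phi> x) \<in> borel_measurable (lebesgue_on B)"
      unfolding A_def using Dum cm[OF D\<phi>c] by measurable
    have Ai: "integrable (lebesgue_on B) (\<lambda>x. A (Du x) \<bullet> D\<phi> x)"
    proof (rule Bochner_Integration.integrable_bound[OF _ Am])
      show "integrable (lebesgue_on B) (\<lambda>x. (1 + norm (Du x) powr p) * X)"
        using Dup by (intro integrable_mult_left Bochner_Integration.integrable_add) auto
      show "AE x in lebesgue_on B. norm (A (Du x) \<bullet> D\<phi> x) \<le> norm ((1 + norm (Du x) powr p) * X)"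
      proof (rule AE_I2)
        fix x assume "x \<in> space (lebesgue_on B)"
        then have x: "x \<in> B" by simp
        have "norm (A (Du x) \<bullet> D\<phi> x) \<le> norm (A (Du x)) * norm (D\<phi> x)"
          using Cauchy_Schwarz_ineq2 by simp
        also have "norm (A (Du x)) = norm (Du x) powr (p - 1)"
          unfolding A_def using p by (intro norm_pLaplace_flux) simp
        also have "norm (Du x) powr (p - 1) * norm (D\<phi> x) \<le> (1 + norm (Du x) powr p) * X"
        proof (rule mult_mono)
          show "norm (Du x) powr (p - 1) \<le> 1 + norm (Du x) powr p"
          proof (cases "norm (Du x) \<le> 1")
            case True
            then have "norm (Du x) powr (p - 1) \<le> 1 powr (p - 1)" using p by (intro powr_mono2) auto
            then show ?thesis by (simp add: add_increasing2)
          next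
            case False
            then have "norm (Du x) powr (p - 1) \<le> norm (Du x) powr p" by (intro powr_mono) auto
            then show ?thesis by simp
          qed
        qed (use X[OF x] X0 in auto)
        finally show "norm (A (Du x) \<bullet> D\<phi> x) \<le> norm ((1 + norm (Du x) powr p) * X)"
          using X0 by simp
      qed
    qed
    have Ei: "integrable (lebesgue_on B) (\<lambda>x. A (D\<Psi> x) \<bullet> D\<phi> x)"
    proof (rule LB.integrable_const_bound[where B="G powr (p - 1) * X"])
      show "(\<lambda>x. A (D\<Psi> x) \<bullet> D\<phi> x) \<in> borel_measurable (lebesgue_on B)"
        unfolding A_def using cm[OF D\<Psi>c] cm[OF D\<phi>c] by measurable
      show "AE x in lebesgue_on B. norm (A (D\<Psi> x) \<bullet> D\<phi> x) \<le> G powr (p - 1) * X"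
      proof (rule AE_I2)
        fix x assume "x \<in> space (lebesgue_on B)"
        then have x: "x \<in> B" by simp
        have "norm (A (D\<Psi> x) \<bullet> D\<phi> x) \<le> norm (A (D\<Psi> x)) * norm (D\<phi> x)"
          using Cauchy_Schwarz_ineq2 by simp
        also have "norm (A (D\<Psi> x)) = norm (D\<Psi> x) powr (p - 1)"
          unfolding A_def using p by (intro norm_pLaplace_flux) simp
        also have "norm (D\<Psi> x) powr (p - 1) * norm (D\<phi> x) \<le> G powr (p - 1) * X"
          using X[OF x] X0 G[OF x] p by (intro mult_mono powr_mono2) auto
        finally show "norm (A (D\<Psi> x) \<bullet> D\<phi> x) \<le> G powr (p - 1) * X" .
      qed
    qed
    have "(LINT x|lebesgue_on \<Omega>. A (Du x) \<bullet> D\<phi> x) = - (LINT x|lebesgue_on \<Omega>. \<Lambda> x * max (u x) 0 powr q * \<phi> x)"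
      unfolding A_def by (rule eq[OF C1 \<phi>0'])
    moreover have "(LINT x|lebesgue_on \<Omega>. A (Du x) \<bullet> D\<phi> x) = (LINT x|lebesgue_on B. A (Du x) \<bullet> D\<phi> x)"
      using B Bs \<Omega>s offB by (intro lebesgue_on_support) auto
    moreover have "(LINT x|lebesgue_on \<Omega>. \<Lambda> x * max (u x) 0 powr q * \<phi> x)
        = (LINT x|lebesgue_on B. \<Lambda> x * max (u x) 0 powr q * \<phi> x)"
      using B Bs \<Omega>s offB by (intro lebesgue_on_support) auto
    ultimately have eq1: "(LINT x|lebesgue_on B. A (Du x) \<bullet> D\<phi> x)
        = - (LINT x|lebesgue_on B. \<Lambda> x * max (u x) 0 powr q * \<phi> x)" by simp
    have lb: "(LINT x|lebesgue_on B. h x) = (LINT x|lborel. h x)"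
      if "h \<in> borel_measurable borel" "\<And>x. x \<notin> B \<Longrightarrow> h x = 0" for h :: "real ^ 'n \<Rightarrow> real"
    proof -
      have "(LINT x|lebesgue_on B. h x) = (LINT x|lebesgue_on UNIV. h x)"
        using Bs that(2) by (intro lebesgue_on_support(2)[symmetric]) auto
      also have "\<dots> = (LINT x|lborel. h x)"
        unfolding lebesgue_on_UNIV_eq by (rule integral_completion) (simp add: that(1))
      finally show ?thesis .
    qed
    have [measurable]: "\<phi> \<in> borel_measurable borel" "D\<phi> \<in> borel_measurable borel"
      using \<phi>c D\<phi>c by (auto intro: borel_measurable_continuous_onI)
    \<comment> \<open>The flux of the barrier is a power times \<open>x - c\<close>, so the Euler identity plays the role of the
       divergence theorem.\<close>
    have "bounded {x. \<phi> x \<noteq> 0}"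
      using offB B(2) by (intro bounded_subset[OF compact_imp_bounded[OF B(2)]]) auto
    from euler_identity[OF \<phi>d D\<phi>c this \<beta>, of c]
    have eu: "(LINT x|lborel. norm (x - c) powr \<beta> * ((x - c) \<bullet> D\<phi> x))
        = - ((CARD('n) + \<beta>) * (LINT x|lborel. norm (x - c) powr \<beta> * \<phi> x))"
      by (simp only: mult_minus_left DIM_cart DIM_real mult_1_right)
    have "(LINT x|lebesgue_on B. A (D\<Psi> x) \<bullet> D\<phi> x)
        = (LINT x|lebesgue_on B. k * (norm (x - c) powr \<beta> * ((x - c) \<bullet> D\<phi> x)))"
      by (simp add: AD\<Psi> mult.assoc)
    also have "\<dots> = (LINT x|lborel. k * (norm (x - c) powr \<beta> * ((x - c) \<bullet> D\<phi> x)))"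
      using offB by (intro lb) auto
    also have "\<dots> = - (LINT x|lborel. \<kappa> * norm (x - c) powr \<beta> * \<phi> x)"
      using eu by (simp add: \<kappa>_def mult.assoc)
    also have "(LINT x|lborel. \<kappa> * norm (x - c) powr \<beta> * \<phi> x) = (LINT x|lebesgue_on B. \<kappa> * norm (x - c) powr \<beta> * \<phi> x)"
      using offB by (intro lb[symmetric]) auto
    finally have eq2: "(LINT x|lebesgue_on B. A (D\<Psi> x) \<bullet> D\<phi> x)
        = - (LINT x|lebesgue_on B. \<kappa> * norm (x - c) powr \<beta> * \<phi> x)" .
    have i1: "integrable (lebesgue_on B) (\<lambda>x. \<Lambda> x * max (u x) 0 powr q * \<phi> x)"
      by (rule bint[OF f1m cm[OF \<phi>c] f1b \<phi>b])
    have i2: "integrable (lebesgue_on B) (\<lambda>x. \<kappa> * norm (x - c) powr \<beta> * \<phi> x)"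
      by (rule bint[OF _ cm[OF \<phi>c] f2b \<phi>b]) (use ncm in auto)
    have i3: "integrable (lebesgue_on B) (\<lambda>x. f x * \<phi> x)"
      by (rule bint[OF fm cm[OF \<phi>c] fb \<phi>b])
    have "(LINT x|lebesgue_on B. f x * \<phi> x)
        = (LINT x|lebesgue_on B. \<Lambda> x * max (u x) 0 powr q * \<phi> x) - (LINT x|lebesgue_on B. \<kappa> * norm (x - c) powr \<beta> * \<phi> x)"
      using i1 i2 by (simp add: f_def left_diff_distrib)
    also have "\<dots> = - (LINT x|lebesgue_on B. A (Du x) \<bullet> D\<phi> x - A (D\<Psi> x) \<bullet> D\<phi> x)"
      using eq1 eq2 Ai Ei by simp
    also have "\<dots> = (LINT x|lebesgue_on B. A (D\<Psi> x) \<bullet> D\<phi> x - A (Du x) \<bullet> D\<phi> x)"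
      using Ai Ei by simp
    also have "\<dots> \<le> (LINT x|lebesgue_on B. 2 * Y * (1 + G powr (p - 1)) * ((1 + norm (Du x)) powr (p - 1) * norm (Dv x - Du x)))"
    proof (rule integral_mono)
      fix x assume "x \<in> space (lebesgue_on B)"
      then have x: "x \<in> B" by simp
      \<comment> \<open>Replacing \<open>Dv\<close> by \<open>Du\<close> in \<open>D\<phi>\<close> isolates a term whose sign is known by monotonicity.\<close>
      have "A (D\<Psi> x) \<bullet> D\<phi> x - A (Du x) \<bullet> D\<phi> x
          = - (g x * ((A (Du x) - A (D\<Psi> x)) \<bullet> (Du x - D\<Psi> x))) + g x * ((A (D\<Psi> x) - A (Du x)) \<bullet> (Dv x - Du x))"
        unfolding D\<phi>g by (simp add: algebra_simps)
      also have "\<dots> \<le> g x * ((A (D\<Psi> x) - A (Du x)) \<bullet> (Dv x - Du x))"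
        using g(1)[OF x] pLaplace_monotone[OF p, of "Du x" "D\<Psi> x"] by (simp add: A_def)
      also have "\<dots> \<le> (2 * Y) * ((1 + G powr (p - 1)) * ((1 + norm (Du x)) powr (p - 1)) * norm (Dv x - Du x))"
      proof -
        have "norm (A (D\<Psi> x) - A (Du x)) \<le> norm (A (D\<Psi> x)) + norm (A (Du x))"
          by (rule norm_triangle_ineq4)
        also have "\<dots> = norm (D\<Psi> x) powr (p - 1) + norm (Du x) powr (p - 1)"
          unfolding A_def using p by (simp add: norm_pLaplace_flux del: norm_scaleR)
        also have "\<dots> \<le> G powr (p - 1) * (1 + norm (Du x)) powr (p - 1) + (1 + norm (Du x)) powr (p - 1)"
        proof (rule add_mono)
          have "norm (D\<Psi> x) powr (p - 1) \<le> G powr (p - 1) * 1"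
            using G[OF x] p by (simp add: powr_mono2)
          also have "\<dots> \<le> G powr (p - 1) * (1 + norm (Du x)) powr (p - 1)"
            using p by (intro mult_left_mono ge_one_powr_ge_zero) auto
          finally show "norm (D\<Psi> x) powr (p - 1) \<le> G powr (p - 1) * (1 + norm (Du x)) powr (p - 1)" .
          show "norm (Du x) powr (p - 1) \<le> (1 + norm (Du x)) powr (p - 1)"
            using p by (intro powr_mono2) auto
        qed
        finally have 1: "norm (A (D\<Psi> x) - A (Du x)) \<le> (1 + G powr (p - 1)) * (1 + norm (Du x)) powr (p - 1)"
          by (simp add: algebra_simps)
        have "(A (D\<Psi> x) - A (Du x)) \<bullet> (Dv x - Du x) \<le> norm (A (D\<Psi> x) - A (Du x)) * norm (Dv x - Du x)"
          by (rule norm_cauchy_schwarz)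
        also have "\<dots> \<le> (1 + G powr (p - 1)) * (1 + norm (Du x)) powr (p - 1) * norm (Dv x - Du x)"
          using 1 by (rule mult_right_mono) simp
        finally have 2: "(A (D\<Psi> x) - A (Du x)) \<bullet> (Dv x - Du x)
            \<le> (1 + G powr (p - 1)) * (1 + norm (Du x)) powr (p - 1) * norm (Dv x - Du x)" .
        have "g x * ((A (D\<Psi> x) - A (Du x)) \<bullet> (Dv x - Du x))
            \<le> g x * ((1 + G powr (p - 1)) * (1 + norm (Du x)) powr (p - 1) * norm (Dv x - Du x))"
          using 2 g(1)[OF x] by (rule mult_left_mono)
        also have "\<dots> \<le> (2 * Y) * ((1 + G powr (p - 1)) * (1 + norm (Du x)) powr (p - 1) * norm (Dv x - Du x))"
          using g(2)[OF x] by (rule mult_right_mono) simp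
        finally show ?thesis .
      qed
      finally show "A (D\<Psi> x) \<bullet> D\<phi> x - A (Du x) \<bullet> D\<phi> x
          \<le> 2 * Y * (1 + G powr (p - 1)) * ((1 + norm (Du x)) powr (p - 1) * norm (Dv x - Du x))"
        by (simp add: mult.assoc)
    qed (use Ai Ei ei in \<open>auto intro!: integrable_mult_right\<close>)
    also have "\<dots> = 2 * Y * (1 + G powr (p - 1)) * (LINT x|lebesgue_on B. (1 + norm (Du x)) powr (p - 1) * norm (Dv x - Du x))"
      by simp
    also have "\<dots> \<le> 2 * Y * (1 + G powr (p - 1)) * \<eta>"
      using e Y by (intro mult_left_mono) auto
    finally have s1: "(LINT x|lebesgue_on B. f x * \<phi> x) \<le> 2 * Y * (1 + G powr (p - 1)) * \<eta>" .
    have "(LINT x|lebesgue_on B. f x * \<phi>0 x) - (LINT x|lebesgue_on B. f x * \<phi> x)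
        = (LINT x|lebesgue_on B. f x * \<phi>0 x - f x * \<phi> x)"
      using f\<phi>0i i3 by simp
    also have "\<dots> \<le> (LINT x|lebesgue_on B. F * (2 * Y * \<eta>))"
    proof (rule integral_mono)
      fix x assume "x \<in> space (lebesgue_on B)"
      then have x: "x \<in> B" by simp
      have "\<bar>\<phi>0 x - \<phi> x\<bar> \<le> 2 * Y * \<eta>"
      proof (cases "x \<in> U")
        case True
        have "\<bar>(max 0 (u x - \<Psi> x - \<delta>))\<^sup>2 - (max 0 (w x))\<^sup>2\<bar> \<le> 2 * Y * \<eta>"
          using vu[OF x] wY[OF x] Y0[OF x] \<Psi>0[of x] \<delta> Y
          by (intro square_pos_part_lipschitz) (auto simp: w_def Y_def)
        then show ?thesis using True by (simp add: \<phi>0_def \<phi>_def)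
      next
        case False
        then have "u x - \<Psi> x - \<delta> \<le> 0" using bU[OF x] \<delta> by force
        then show ?thesis using False Y \<eta> by (simp add: \<phi>0_def \<phi>_def)
      qed
      then have "\<bar>f x * (\<phi>0 x - \<phi> x)\<bar> \<le> F * (2 * Y * \<eta>)"
        unfolding abs_mult using fb[OF x] F0 by (intro mult_mono) auto
      then show "f x * \<phi>0 x - f x * \<phi> x \<le> F * (2 * Y * \<eta>)"
        by (simp add: right_diff_distrib)
    qed (use f\<phi>0i i3 in auto)
    also have "\<dots> = measure (lebesgue_on B) B * (F * (2 * Y)) * \<eta>" by simp
    finally show ?thesis using s1 by (simp add: Z_def distrib_right)
  qed
  have lim: "(\<lambda>n. Z * (min 1 \<delta> / real (Suc n))) \<longlonglongrightarrow> Z * 0"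
    by (intro tendsto_mult_left LIMSEQ_Suc[OF lim_const_over_n])
  have step: "(LINT x|lebesgue_on B. f x * \<phi>0 x) \<le> Z * (min 1 \<delta> / real (Suc n))" for n
  proof (rule main)
    show "min 1 \<delta> / real (Suc n) \<le> min 1 \<delta>"
      using \<delta> divide_left_mono[of 1 "real (Suc n)" "min 1 \<delta>"] by simp
  qed (use \<delta> in auto)
  have le0: "(LINT x|lebesgue_on B. f x * \<phi>0 x) \<le> 0"
    using LIMSEQ_le_const[OF lim, of "LINT x|lebesgue_on B. f x * \<phi>0 x"] step by auto
  have pos: "0 < f x" if x: "x \<in> B" "u x - \<Psi> x > \<delta>" for x
  proof -
    have u0: "0 < u x" using x \<delta> \<Psi>0[of x] by linarith
    have "C powr q * norm (x - c) powr \<beta> = \<Psi> x powr q"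
      using C by (simp add: \<Psi>_def \<beta>_def powr_mult powr_powr)
    also have "\<dots> \<le> u x powr q" using x \<delta> \<Psi>0[of x] q by (intro powr_mono2) auto
    finally have 1: "C powr q * norm (x - c) powr \<beta> \<le> u x powr q" .
    have "\<kappa> * norm (x - c) powr \<beta> = \<kappa> / C powr q * (C powr q * norm (x - c) powr \<beta>)"
      using C by simp
    also have "\<dots> \<le> \<kappa> / C powr q * u x powr q"
      using 1 \<kappa>0 by (intro mult_left_mono) auto
    also have "\<dots> < m * u x powr q"
      using \<kappa> C u0 by (intro mult_strict_right_mono) (auto simp: divide_less_eq)
    also have "\<dots> \<le> \<Lambda> x * u x powr q"
      using \<Lambda>[of x] x B by (intro mult_right_mono) auto
    finally show ?thesis using u0 by (simp add: f_def)
  qed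
  have nn: "0 \<le> f x * \<phi>0 x" if "x \<in> B" for x
  proof (cases "u x - \<Psi> x > \<delta>")
    case True
    then show ?thesis using pos[OF that] by (simp add: \<phi>0_def)
  qed (simp add: \<phi>0_def)
  have "(LINT x|lebesgue_on B. f x * \<phi>0 x) = 0"
    using le0 nn by (intro antisym integral_nonneg_AE AE_I2) auto
  then have "AE x in lebesgue_on B. f x * \<phi>0 x = 0"
    using nn by (subst (asm) integral_nonneg_eq_0_iff_AE[OF f\<phi>0i]) (auto intro!: AE_I2)
  then have ae: "AE x in lebesgue. x \<in> B \<longrightarrow> f x * \<phi>0 x = 0"
    using Bs by (simp add: AE_restrict_space_iff)
  define V where "V = {x \<in> U. \<Psi> x + \<delta> < u x}"
  have "open V"
  proof -
    have "continuous_on U (\<lambda>x. u x - (\<Psi> x + \<delta>))"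
      by (intro continuous_intros \<Psi>c continuous_on_subset[OF cB B(3)])
    then have "open ((\<lambda>x. u x - (\<Psi> x + \<delta>)) -` {0<..} \<inter> U)"
      using continuous_on_open_vimage[OF B(4)] open_greaterThan by blast
    moreover have "(\<lambda>x. u x - (\<Psi> x + \<delta>)) -` {0<..} \<inter> U = V"
      by (auto simp: V_def)
    ultimately show ?thesis by simp
  qed
  moreover have "x2 \<in> V"
    using bU[OF B(5)] x2' \<delta> by (simp add: V_def) (simp add: \<delta>_def field_simps)
  moreover have "negligible V"
  proof -
    have "AE x in lebesgue. x \<notin> V"
      using ae
    proof eventually_elim
      case (elim x)
      show ?case
      proof
        assume "x \<in> V"
        then have "x \<in> B" "u x - \<Psi> x > \<delta>" using B(3) by (auto simp: V_def)
        then show False using pos[of x] elim by (simp add: \<phi>0_def)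
      qed
    qed
    then show ?thesis
      using \<open>open V\<close> by (simp add: negligible_iff_null_sets AE_iff_null_sets)
  qed
  ultimately show False using open_not_negligible by blast
qed

section \<open>Nondegeneracy\<close>

lemma cball_subset_if_less_setdist:
  fixes x0 :: "'a::euclidean_space"
  assumes "x0 \<in> S" "S \<subseteq> \<Omega>" "R < setdist S (frontier \<Omega>)"
  shows "cball x0 R \<subseteq> \<Omega>"
proof (rule ccontr)
  assume no: "\<not> cball x0 R \<subseteq> \<Omega>"
  then have "x0 \<in> cball x0 R" by force
  then have "cball x0 R \<inter> \<Omega> \<noteq> {}" using assms(1,2) by blast
  moreover have "cball x0 R - \<Omega> \<noteq> {}" using no by blast
  ultimately have "cball x0 R \<inter> frontier \<Omega> \<noteq> {}"
    by (rule connected_Int_frontier[OF connected_cball])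
  then obtain y where "y \<in> frontier \<Omega>" "dist x0 y \<le> R" by auto
  then show False using setdist_le_dist[OF assms(1), of y "frontier \<Omega>"] assms(3) by linarith
qed

theorem theorem1p1:
  fixes p q m :: real
  assumes "2 \<le> p" and "0 \<le> q" and "q < p - 1" and "0 < m"
  shows "\<exists>C>0. \<forall>(\<Omega> :: (real ^ 'n) set) \<Lambda> g u \<Omega>' x0.
    open \<Omega> \<and> connected \<Omega> \<and> \<Omega> \<noteq> {} \<and> bounded \<Omega> \<and>
    \<Lambda> \<in> borel_measurable (lebesgue_on \<Omega>) \<and> bounded (\<Lambda> ` \<Omega>) \<and> (INF x\<in>\<Omega>. \<Lambda> x) = m \<and>
    continuous_on (frontier \<Omega>) g \<and> (\<forall>x\<in>frontier \<Omega>. 0 \<le> g x) \<and>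
    weak_solution p q \<Omega> \<Lambda> g u \<and> (\<forall>x\<in>\<Omega>. 0 \<le> u x) \<and> bounded (u ` \<Omega>) \<and>
    compact (closure \<Omega>') \<and> closure \<Omega>' \<subseteq> \<Omega> \<and>
    x0 \<in> closure {x\<in>\<Omega>. 0 < u x} \<inter> \<Omega>' \<longrightarrow>
    (\<forall>r. 0 < r \<and> r < min 1 (setdist \<Omega>' (frontier \<Omega>)) \<longrightarrow>
       C * r powr (p / (p - 1 - q)) \<le> (SUP x\<in>sphere x0 r. u x))"
proof -
  define \<alpha> where "\<alpha> = p / (p - 1 - q)"
  have \<alpha>: "0 < \<alpha>" using assms by (simp add: \<alpha>_def)
  obtain C where C: "0 < C" and Cm: "(C * \<alpha>) powr (p - 1) * (CARD('n) + \<alpha> * q) < m * C powr q"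
    using barrier_constant_exists[of p q m "CARD('n)"] assms unfolding \<alpha>_def by auto
  have "C * r powr \<alpha> \<le> (SUP x\<in>sphere x0 r. u x)"
    if \<Omega>: "open \<Omega>" and \<Lambda>m: "\<Lambda> \<in> borel_measurable (lebesgue_on \<Omega>)"
      and \<Lambda>b: "bounded (\<Lambda> ` \<Omega>)" and \<Lambda>i: "(INF x\<in>\<Omega>. \<Lambda> x) = m"
      and sol: "weak_solution p q \<Omega> \<Lambda> g u"
      and \<Omega>': "closure \<Omega>' \<subseteq> \<Omega>"
      and x0: "x0 \<in> closure {x\<in>\<Omega>. 0 < u x}" "x0 \<in> \<Omega>'"
      and r: "0 < r" "r < setdist \<Omega>' (frontier \<Omega>)"
    for \<Omega> :: "(real ^ 'n) set" and \<Lambda> g u \<Omega>' x0 r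
  proof (rule ccontr)
    define s where "s = (SUP x\<in>sphere x0 r. u x)"
    assume "\<not> C * r powr \<alpha> \<le> (SUP x\<in>sphere x0 r. u x)"
    then have s: "s < C * r powr \<alpha>" by (simp add: s_def)
    obtain Du where W: "W1p_loc p \<Omega> u Du"
      and eq: "\<And>\<phi> D\<phi>. C1_0 \<Omega> \<phi> D\<phi> \<Longrightarrow> (\<And>x. 0 \<le> \<phi> x) \<Longrightarrow>
        (LINT x|lebesgue_on \<Omega>. (norm (Du x) powr (p - 2) *\<^sub>R Du x) \<bullet> D\<phi> x)
          = - (LINT x|lebesgue_on \<Omega>. \<Lambda> x * max (u x) 0 powr q * \<phi> x)"
      and ucl: "continuous_on (closure \<Omega>) u"
      using sol unfolding weak_solution_def by blast
    from ucl have uc: "continuous_on \<Omega> u" by (rule continuous_on_subset[OF _ closure_subset])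
    define R where "R = (r + setdist \<Omega>' (frontier \<Omega>)) / 2"
    have R: "r < R" "R < setdist \<Omega>' (frontier \<Omega>)" using r by (auto simp: R_def)
    have sub: "cball x0 R \<subseteq> \<Omega>"
      using \<Omega>' closure_subset[of \<Omega>'] x0(2) R(2) by (intro cball_subset_if_less_setdist) auto
    have us: "u x \<le> s" if "x \<in> sphere x0 r" for x
      unfolding s_def
    proof (rule cSUP_upper[OF that])
      have "sphere x0 r \<subseteq> \<Omega>" using sub R(1) by auto
      then show "bdd_above (u ` sphere x0 r)"
        by (intro bounded_imp_bdd_above compact_imp_bounded compact_continuous_image
            continuous_on_subset[OF uc] compact_sphere)
    qed
    \<comment> \<open>The strict inequality survives on a slightly smaller radius \<open>r'\<close>, which pays for moving the
       centre of the barrier from \<open>x0\<close> to a nearby point \<open>x1\<close> where \<open>u\<close> is positive.\<close>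
    have "isCont (\<lambda>t. C * t powr \<alpha>) r" using r by (intro continuous_intros) auto
    then have "\<forall>\<^sub>F t in at r. s < C * t powr \<alpha>"
      using s unfolding isCont_def by (rule order_tendstoD)
    then obtain d where d: "0 < d" "\<And>t. t \<noteq> r \<Longrightarrow> dist t r < d \<Longrightarrow> s < C * t powr \<alpha>"
      unfolding eventually_at by blast
    define r' where "r' = r - min d r / 2"
    have r': "0 < r'" "r' < r" using d(1) r(1) by (auto simp: r'_def)
    have sr': "s < C * r' powr \<alpha>"
      using d r by (intro d(2)) (auto simp: r'_def dist_real_def)
    obtain x1 where x1: "x1 \<in> \<Omega>" "0 < u x1" "dist x1 x0 < r - r'"
      using x0(1)[unfolded closure_approachable, rule_format, of "r - r'"] r' by auto
    obtain L where L: "\<And>x. x \<in> \<Omega> \<Longrightarrow> \<bar>\<Lambda> x\<bar> \<le> L"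
      using \<Lambda>b by (auto simp: bounded_iff)
    have "u x1 \<le> C * norm (x1 - x1) powr \<alpha>"
    proof (rule barrier_comparison[OF assms(1-3) \<Omega> sub r(1) R(1) \<Lambda>m L _ W uc eq C \<alpha>_def Cm])
      show "m \<le> \<Lambda> x" if "x \<in> \<Omega>" for x
        unfolding \<Lambda>i[symmetric] using bounded_imp_bdd_below[OF \<Lambda>b] that by (rule cINF_lower)
      show "u x < C * norm (x - x1) powr \<alpha>" if x: "x \<in> sphere x0 r" for x
      proof -
        have "r \<le> dist x1 x0 + norm (x - x1)"
          using x dist_triangle[of x0 x x1] by (simp add: dist_norm norm_minus_commute)
        then have "r' \<le> norm (x - x1)" using x1(3) by simp
        then have "C * r' powr \<alpha> \<le> C * norm (x - x1) powr \<alpha>"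
          using C r' \<alpha> by (intro mult_left_mono powr_mono2) auto
        then show ?thesis using us[OF x] sr' by linarith
      qed
      show "x1 \<in> cball x0 r" using x1(3) r' by (simp add: dist_commute)
    qed
    then show False using x1(2) by simp
  qed
  with C show ?thesis
    unfolding \<alpha>_def by (intro exI[of _ C]) auto
qed

end
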